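(* Let $G$ be a simple, finite, connected, undirected partial 2-tree with $n$ vertices and $m$ edges, equipped with an edge weight function $w: E(G)\to \mathbb{N}$ and a total order on $V(G)$. Then the number of lex short cycles of $G$ is $m-n+1$.
   Context: A 2-tree is defined inductively: $K_3$ is a 2-tree; if $G'$ is a 2-tree and $G$ is obtained from $G'$ by adding a new vertex $v$ whose neighbourhood in $G$ induces a $K_2$ (an edge) of $G'$, then $G$ is a 2-tree. A partial 2-tree is a subgraph of a 2-tree (equivalently, a graph of treewidth at most two). For a path $P$, $w(P)=\sum_{e\in E(P)} w(e)$. Given the total order on $V(G)$, a path $P$ between distinct vertices $u,v$ is the lex shortest path if for every other $u$–$v$ path $P'$ exactly one of the following holds: (1) $w(P')>w(P)$; (2) $w(P')=w(P)$ and $|E(P')|>|E(P)|$; (3) $w(P')=w(P)$, $|E(P')|=|E(P)|$ and $\min(V(P')\setminus V(P))>\min(V(P)\setminus V(P'))$. This path is unique and denoted $lsp(u,v)$. A cycle $C$ of $G$ is lex short if for every two vertices $x,y\in V(C)$, $lsp(x,y)$ is contained in $C$. *)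

theory Defs
  imports Main
begin

datatype 'a ugraph = UGraph (nodes: "'a set") (edges: "'a set set")

definition simple_graph :: "'a ugraph \<Rightarrow> bool" where
  "simple_graph G \<longleftrightarrow>
     finite (nodes G) \<and> (\<forall>e \<in> edges G. e \<subseteq> nodes G \<and> card e = 2)"

definition is_subgraph :: "'a ugraph \<Rightarrow> 'a ugraph \<Rightarrow> bool" where
  "is_subgraph H G \<longleftrightarrow> nodes H \<subseteq> nodes G \<and> edges H \<subseteq> edges G"

definition consecutive_pairs :: "'a list \<Rightarrow> 'a set set" where
  "consecutive_pairs xs = {{xs ! i, xs ! Suc i} | i. Suc i < length xs}"

text \<open>
  Paths and cycles are subgraphs, not vertex sequences. So a path does not depend on the direction
  in which it is traversed, and a cycle is counted once, whatever its starting point and direction.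
\<close>

definition path_graph :: "'a list \<Rightarrow> 'a ugraph" where
  "path_graph xs = UGraph (set xs) (consecutive_pairs xs)"

definition cycle_graph :: "'a list \<Rightarrow> 'a ugraph" where
  "cycle_graph xs = UGraph (set xs) (insert {last xs, hd xs} (consecutive_pairs xs))"

definition path_between :: "'a ugraph \<Rightarrow> 'a \<Rightarrow> 'a \<Rightarrow> 'a ugraph \<Rightarrow> bool" where
  "path_between G u v P \<longleftrightarrow>
     is_subgraph P G \<and>
     (\<exists>xs. xs \<noteq> [] \<and> distinct xs \<and> hd xs = u \<and> last xs = v \<and> P = path_graph xs)"

definition cycle_of :: "'a ugraph \<Rightarrow> 'a ugraph \<Rightarrow> bool" where
  "cycle_of G C \<longleftrightarrow>
     is_subgraph C G \<and> (\<exists>xs. length xs \<ge> 3 \<and> distinct xs \<and> C = cycle_graph xs)"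

definition connected_graph :: "'a ugraph \<Rightarrow> bool" where
  "connected_graph G \<longleftrightarrow>
     nodes G \<noteq> {} \<and> (\<forall>u \<in> nodes G. \<forall>v \<in> nodes G. \<exists>P. path_between G u v P)"

inductive two_tree :: "'a ugraph \<Rightarrow> bool" where
  triangle:
    "distinct [a, b, c] \<Longrightarrow> two_tree (UGraph {a, b, c} {{a, b}, {b, c}, {a, c}})"
| extend:
    "two_tree G \<Longrightarrow> v \<notin> nodes G \<Longrightarrow> {a, b} \<in> edges G \<Longrightarrow>
     two_tree (UGraph (insert v (nodes G)) (edges G \<union> {{v, a}, {v, b}}))"

text \<open>
  The 2-tree may have vertices outside \<open>G\<close>, and the type \<open>'a\<close> may have no elements left for them
  (\<open>K\<^sub>2\<close> on a two-element type, say). It is therefore taken over \<open>nat\<close>, which has a copy of every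
  finite graph, and \<open>G\<close> is embedded in it by an injection.
\<close>

definition partial_two_tree :: "'a ugraph \<Rightarrow> bool" where
  "partial_two_tree G \<longleftrightarrow>
     (\<exists>(H :: nat ugraph) f. two_tree H \<and> inj_on f (nodes G) \<and>
        is_subgraph (UGraph (f ` nodes G) ((`) f ` edges G)) H)"

definition graph_weight :: "('a set \<Rightarrow> nat) \<Rightarrow> 'a ugraph \<Rightarrow> nat" where
  "graph_weight w P = (\<Sum>e \<in> edges P. w e)"

text \<open>
  The three alternatives exclude each other, so their disjunction says that exactly one of them
  holds. Two paths with equally many edges have equally many vertices, so in the third alternative
  the two set differences are both nonempty or both empty; in the latter case the strict inequality
  is false, whatever the value of \<open>Min {}\<close>.
\<close>

definition is_lex_shortest_path ::
  "'a::linorder ugraph \<Rightarrow> ('a set \<Rightarrow> nat) \<Rightarrow> 'a \<Rightarrow> 'a \<Rightarrow> 'a ugraph \<Rightarrow> bool" where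
  "is_lex_shortest_path G w u v P \<longleftrightarrow>
     path_between G u v P \<and>
     (\<forall>P'. path_between G u v P' \<and> P' \<noteq> P \<longrightarrow>
        graph_weight w P' > graph_weight w P \<or>
        graph_weight w P' = graph_weight w P \<and> card (edges P') > card (edges P) \<or>
        graph_weight w P' = graph_weight w P \<and> card (edges P') = card (edges P) \<and>
          Min (nodes P' - nodes P) > Min (nodes P - nodes P'))"

definition lsp ::
  "'a::linorder ugraph \<Rightarrow> ('a set \<Rightarrow> nat) \<Rightarrow> 'a \<Rightarrow> 'a \<Rightarrow> 'a ugraph" where
  "lsp G w u v = (THE P. is_lex_shortest_path G w u v P)"

definition lex_short_cycle ::
  "'a::linorder ugraph \<Rightarrow> ('a set \<Rightarrow> nat) \<Rightarrow> 'a ugraph \<Rightarrow> bool" where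
  "lex_short_cycle G w C \<longleftrightarrow>
     cycle_of G C \<and>
     (\<forall>x \<in> nodes C. \<forall>y \<in> nodes C. x \<noteq> y \<longrightarrow> is_subgraph (lsp G w x y) C)"

end

(*
  Ties are broken by perturbing the weights: the order on paths is realised by one natural-valued
  edge weight for which shortest paths are unique. A subpath of a shortest path is then again the
  shortest path, and the count goes by induction along the construction of the 2-tree, removing a
  vertex v of degree at most two.

  A vertex of degree at most one lies on no cycle. If v has neighbours a and b and the shortest path
  from a to b avoids v, then every short cycle through v contains this path, hence is its union with
  a-v-b, and this union is short. So deleting v costs two edges, one vertex and one cycle. In the
  same way an edge ab that is not the shortest path between its ends lies on exactly one short cycle
  and can be deleted. Otherwise a-v-b is the shortest path; the edge ab, if present, is deleted, and
  then a-v-b is replaced by an edge ab of the same length, which preserves short cycles.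
*)

theory Submission
  imports Defs
begin

text \<open>The lex rule compares vertices, and a contracted vertex would take its label away. Once
  the labels are stored in the edges, the new edge inherits the share of the vertex it replaces, and
  the rule survives as a plain edge weight. Labels enter in binary, complemented so that small
  labels make a path light. The obstacle: two paths with equal \<open>w\<close> and the same
  vertices in a different order tie under the rule, so the perturbed weights still tie on some pairs
  of paths. Only the minimum is unique, by an exchange of prefixes, and the invariant
  \<open>geodetic\<close> demands no more than that. The vertex to remove is given by the 2-tree, of
  which the graph is merely a subgraph; so the induction speaks of all subgraphs and all weights. It
  closes because a contraction adds an edge between the two neighbours of the removed vertex, and
  these are already adjacent in the smaller 2-tree.\<close>

section \<open>Paths and cycles as edge sets\<close>

text \<open>With its ends given, a path is determined by its edge set. Its vertices are
  \<open>insert x (\<Union>P)\<close>, since the trivial path has no edge to cover \<open>x\<close>.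
  For the same reason \<open>step\<close> asks for \<open>x \<noteq> y\<close> besides
  \<open>x \<notin> \<Union>P\<close>.\<close>

inductive gpath :: "'a \<Rightarrow> 'a \<Rightarrow> 'a set set \<Rightarrow> bool" where
  refl: "gpath x x {}"
| step: "gpath y z P \<Longrightarrow> x \<noteq> y \<Longrightarrow> x \<notin> \<Union>P \<Longrightarrow> gpath x z (insert {x, y} P)"

lemma gpath_finite: "gpath x y P \<Longrightarrow> finite P"
  by (induction rule: gpath.induct) auto

lemma gpath_ends: "gpath x y P \<Longrightarrow> P = {} \<and> x = y \<or> x \<noteq> y \<and> x \<in> \<Union>P \<and> y \<in> \<Union>P"
  by (induction rule: gpath.induct) auto

lemma gpath_empty_iff: "gpath x y P \<Longrightarrow> P = {} \<longleftrightarrow> x = y"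
  using gpath_ends by fastforce

lemma gpath_refl_iff [simp]: "gpath x x P \<longleftrightarrow> P = {}"
  using gpath_empty_iff gpath.refl by metis

lemma gpath_empty [simp]: "gpath x y {} \<longleftrightarrow> x = y"
  using gpath_empty_iff gpath.refl by metis

lemma gpath_edge: "x \<noteq> y \<Longrightarrow> gpath x y {{x, y}}"
  using gpath.step[OF gpath.refl, of x y] by simp

lemma gpath_first:
  assumes "gpath x z P" "x \<noteq> z"
  obtains y Q where "P = insert {x, y} Q" "gpath y z Q" "x \<noteq> y" "x \<notin> \<Union>Q" "{x, y} \<notin> Q"
proof -
  from assms(1) show thesis
  proof (cases rule: gpath.cases)
    case (step y Q)
    then show ?thesis using that[of y Q] by auto
  qed (use assms(2) in simp)
qed

lemma gpath_append:
  assumes "gpath x y P" "gpath y z Q" "insert x (\<Union>P) \<inter> insert z (\<Union>Q) \<subseteq> {y}"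
  shows "gpath x z (P \<union> Q)"
  using assms
proof (induction arbitrary: z rule: gpath.induct)
  case (refl x)
  then show ?case by simp
next
  case (step y u P x)
  have "gpath y z (P \<union> Q)"
    using step.IH[of z] step.prems step.hyps by auto
  moreover have "x \<notin> \<Union>(P \<union> Q)"
    using step.hyps step.prems gpath_ends[of y u P] by auto
  ultimately show ?case
    using gpath.step[of y z "P \<union> Q" x] step.hyps by simp
qed

lemma gpath_sym: "gpath x y P \<Longrightarrow> gpath y x P"
proof (induction rule: gpath.induct)
  case (refl x)
  then show ?case by (rule gpath.refl)
next
  case (step y z P x)
  have "gpath z x (P \<union> {{y, x}})"
    by (rule gpath_append[OF step.IH gpath_edge])
      (use step.hyps gpath_ends[of y z P] in auto)
  then show ?case by (simp add: insert_commute)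
qed

lemma gpath_split:
  assumes "gpath x z P" "y \<in> insert x (\<Union>P)"
  shows "\<exists>P1 P2. P = P1 \<union> P2 \<and> P1 \<inter> P2 = {} \<and> gpath x y P1 \<and> gpath y z P2 \<and>
    insert x (\<Union>P1) \<inter> insert z (\<Union>P2) = {y}"
  using assms
proof (induction rule: gpath.induct)
  case (refl x)
  then show ?case by - (rule exI[of _ "{}"], auto)
next
  case (step u z P x)
  show ?case
  proof (cases "y = x")
    case True
    then show ?thesis
      using gpath.step[OF step.hyps] gpath_ends[OF gpath.step[OF step.hyps]]
      by - (rule exI[of _ "{}"], rule exI[of _ "insert {x, u} P"], auto)
  next
    case False
    then have "y \<in> insert u (\<Union>P)" using step.prems by auto
    from step.IH[OF this] obtain P1 P2 where *: "P = P1 \<union> P2" "P1 \<inter> P2 = {}" "gpath u y P1"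
      "gpath y z P2" "insert u (\<Union>P1) \<inter> insert z (\<Union>P2) = {y}" by blast
    have "gpath x y (insert {x, u} P1)"
      using * step.hyps by (intro gpath.step) auto
    moreover have "{x, u} \<notin> P" using step.hyps by auto
    moreover have "x \<noteq> z" using gpath_ends[OF step.hyps(1)] step.hyps by auto
    ultimately show ?thesis
      using * step.hyps(2,3) by - (rule exI[of _ "insert {x, u} P1"], rule exI[of _ P2], auto)
  qed
qed

text \<open>The set \<open>{a, b}\<close> does not tell which end the path meets first;
  \<open>c\<close>, \<open>d\<close> are the same two vertices in the order of traversal.\<close>

lemma gpath_split_edge:
  assumes "gpath x y P" "{a, b} \<in> P"
  shows "\<exists>c d P1 P2. {a, b} = {c, d} \<and> P = insert {c, d} (P1 \<union> P2) \<and> gpath x c P1 \<and> gpath d y P2 \<and>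
    insert x (\<Union>P1) \<inter> insert y (\<Union>P2) = {}"
  using assms
proof (induction rule: gpath.induct)
  case (refl x)
  then show ?case by simp
next
  case (step u y P x)
  have xy: "x \<noteq> y" using gpath_ends[OF step.hyps(1)] step.hyps by auto
  show ?case
  proof (cases "{a, b} \<in> P")
    case True
    from step.IH[OF this] obtain c d P1 P2 where *: "{a, b} = {c, d}"
      "P = insert {c, d} (P1 \<union> P2)" "gpath u c P1" "gpath d y P2"
      "insert u (\<Union>P1) \<inter> insert y (\<Union>P2) = {}" by (elim exE conjE)
    have "gpath x c (insert {x, u} P1)"
      using * step.hyps by (intro gpath.step) auto
    moreover have "insert x (\<Union>(insert {x, u} P1)) \<inter> insert y (\<Union>P2) = {}"
    proof -
      have "x \<notin> \<Union>P2" using *(2) step.hyps(3) by simp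
      then show ?thesis using *(5) xy by simp
    qed
    moreover have "insert {x, u} P = insert {c, d} (insert {x, u} P1 \<union> P2)"
      by (simp only: *(2) insert_commute Un_insert_left)
    ultimately show ?thesis using *(1,4)
      by - (rule exI[of _ c], rule exI[of _ d],
        rule exI[of _ "insert {x, u} P1"], rule exI[of _ P2], simp)
  next
    case False
    then have "{a, b} = {x, u}" using step.prems by auto
    moreover have "insert x (\<Union>{}) \<inter> insert y (\<Union>P) = {}"
      using step.hyps(3) xy by simp
    moreover have "insert {x, u} P = insert {x, u} ({} \<union> P)" by simp
    ultimately show ?thesis using step.hyps(1)
      by - (rule exI[of _ x], rule exI[of _ u], rule exI[of _ "{}"], rule exI[of _ P], simp)
  qed
qed

lemma gpath_inner:
  assumes "gpath x y P" "v \<in> \<Union>P" "v \<noteq> x" "v \<noteq> y"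
  shows "\<exists>c d P1 P2. P = {{c, v}, {v, d}} \<union> (P1 \<union> P2) \<and> gpath x c P1 \<and> gpath d y P2 \<and>
    insert x (\<Union>P1) \<inter> insert y (\<Union>P2) = {} \<and> v \<notin> \<Union>P1 \<and> v \<notin> \<Union>P2 \<and>
    c \<noteq> d \<and> c \<noteq> v \<and> d \<noteq> v"
proof -
  obtain Q1 Q2 where Q: "P = Q1 \<union> Q2" "gpath x v Q1" "gpath v y Q2"
    "insert x (\<Union>Q1) \<inter> insert y (\<Union>Q2) = {v}"
    using gpath_split[OF assms(1), of v] assms(2) by blast
  obtain c P1 where c: "Q1 = insert {v, c} P1" "gpath c x P1" "v \<noteq> c" "v \<notin> \<Union>P1"
    using gpath_first[OF gpath_sym[OF Q(2)]] assms(3) by metis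
  obtain d P2 where d: "Q2 = insert {v, d} P2" "gpath d y P2" "v \<noteq> d" "v \<notin> \<Union>P2"
    using gpath_first[OF Q(3)] assms(4) by metis
  have disj: "insert x (\<Union>P1) \<inter> insert y (\<Union>P2) = {}"
  proof -
    have "insert x (\<Union>P1) \<inter> insert y (\<Union>P2) \<subseteq> insert x (\<Union>Q1) \<inter> insert y (\<Union>Q2)"
      using c(1) d(1) by auto
    moreover have "v \<notin> insert x (\<Union>P1)" using c(4) assms(3) by simp
    ultimately show ?thesis unfolding Q(4) by auto
  qed
  have "c \<in> insert x (\<Union>P1)" "d \<in> insert y (\<Union>P2)"
    using gpath_ends[OF c(2)] gpath_ends[OF d(2)] by auto
  then have "c \<noteq> d" using disj by blast
  moreover have "P = {{c, v}, {v, d}} \<union> (P1 \<union> P2)"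
    using Q(1) c(1) d(1) by (auto simp: insert_commute)
  ultimately show ?thesis using disj c(4) d(2,4) c(3)[symmetric] d(3)[symmetric] gpath_sym[OF c(2)]
    by - (rule exI[of _ c], rule exI[of _ d], rule exI[of _ P1], rule exI[of _ P2], (intro conjI; assumption))
qed

text \<open>The two paths may cross. Prepending the first vertex of \<open>R\<close> to a path
  \<open>S\<close> found for the rest either works, or \<open>S\<close> returns to that vertex and
  its tail from there is the path sought.\<close>

lemma gpath_trans:
  assumes "gpath x y R" "gpath y z P"
  shows "\<exists>S \<subseteq> R \<union> P. gpath x z S"
  using assms
proof (induction rule: gpath.induct)
  case (refl x)
  then show ?case by auto
next
  case (step u y R x)
  then obtain S where S: "S \<subseteq> R \<union> P" "gpath u z S" by auto
  show ?case
  proof (cases "x \<in> \<Union>S")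
    case True
    then have "x \<in> insert u (\<Union>S)" by simp
    from gpath_split[OF S(2) this] obtain S1 S2 where "S = S1 \<union> S2" "gpath x z S2"
      by (elim exE conjE)
    then show ?thesis using S(1) by (intro exI[of _ S2]) auto
  next
    case False
    then have "gpath x z (insert {x, u} S)" using S step.hyps by (intro gpath.step)
    then show ?thesis using S(1) by (intro exI[of _ "insert {x, u} S"]) auto
  qed
qed

text \<open>A path contains no cycle. In the induction the first vertex \<open>x\<close> lies on the
  edge \<open>{x, w}\<close> only, so a nontrivial subpath either ends at \<open>x\<close> and uses
  this edge or avoids \<open>x\<close>. Often used to turn an inclusion of two paths with the same
  ends into an equality.\<close>

lemma gpath_subpath_unique:
  assumes "gpath x y P" "gpath u v Q" "Q \<subseteq> P" "gpath u v R" "R \<subseteq> P"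
  shows "Q = R"
  using assms
proof (induction arbitrary: u v Q R rule: gpath.induct)
  case (refl x)
  then show ?case by simp
next
  case (step w y P x)
  have start: "Q = R" if h: "gpath x t Q" "Q \<subseteq> insert {x, w} P" "gpath x t R" "R \<subseteq> insert {x, w} P"
    for t Q R
  proof (cases "t = x")
    case True
    then show ?thesis using h by simp
  next
    case False
    obtain q Q' where q: "Q = insert {x, q} Q'" "gpath q t Q'" "x \<noteq> q" "x \<notin> \<Union>Q'"
      using gpath_first[OF h(1)] False by metis
    obtain r R' where r: "R = insert {x, r} R'" "gpath r t R'" "x \<noteq> r" "x \<notin> \<Union>R'"
      using gpath_first[OF h(3)] False by metis
    have e: "q = w" "r = w" using q r h step.hyps by (auto simp: doubleton_eq_iff)
    have "Q' \<subseteq> P" "R' \<subseteq> P" using q r h by auto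
    then show ?thesis using step.IH[of w t Q' R'] e q r by auto
  qed
  have avoid: "Q \<subseteq> P" if Q: "gpath u v Q" "Q \<subseteq> insert {x, w} P" "x \<noteq> u" "x \<noteq> v" for Q
  proof -
    have "x \<notin> \<Union>Q"
    proof
      assume "x \<in> \<Union>Q"
      from gpath_inner[OF Q(1) this Q(3,4)] obtain c d
        where "{c, x} \<in> Q" "{x, d} \<in> Q" "c \<noteq> d" by blast
      then have "{c, x} = {x, w}" "{x, d} = {x, w}" using Q(2) step.hyps(3) by auto
      then show False using \<open>c \<noteq> d\<close> by (auto simp: doubleton_eq_iff)
    qed
    then show ?thesis using Q by auto
  qed
  show ?case
  proof (cases "x = u \<or> x = v")
    case True
    then show ?thesis using start step.prems gpath_sym by metis
  next
    case False
    then show ?thesis using step.IH[of u v Q R] step.prems avoid[of Q] avoid[of R] by auto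
  qed
qed

text \<open>The condition \<open>{x, y} \<notin> P\<close> rules out the single edge as
  \<open>P\<close>, so \<open>P\<close> has at least two edges and no cycle of length two
  arises.\<close>

definition cyc :: "'a set set \<Rightarrow> bool" where
  "cyc C \<longleftrightarrow> (\<exists>x y P. gpath x y P \<and> x \<noteq> y \<and> {x, y} \<notin> P \<and> C = insert {x, y} P)"

lemma cycI: "gpath x y P \<Longrightarrow> x \<noteq> y \<Longrightarrow> {x, y} \<notin> P \<Longrightarrow> cyc (insert {x, y} P)"
  unfolding cyc_def by blast

text \<open>Any edge may serve as the closing edge: without \<open>{c, d}\<close> the path falls
  into \<open>P1\<close> and \<open>P2\<close>, and the old closing edge \<open>{x, y}\<close> joins
  them at their other ends.\<close>

lemma cyc_rotate:
  assumes "cyc C" "{a, b} \<in> C"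
  shows "\<exists>P. gpath a b P \<and> a \<noteq> b \<and> {a, b} \<notin> P \<and> C = insert {a, b} P"
proof -
  have turn: "\<exists>P. gpath a b P \<and> a \<noteq> b \<and> {a, b} \<notin> P \<and> C = insert {a, b} P"
    if "{a, b} = {c, d}" "gpath c d P" "c \<noteq> d" "{c, d} \<notin> P" "C = insert {c, d} P" for c d P
  proof -
    have "a = c \<and> b = d \<or> a = d \<and> b = c" using that(1) by (simp only: doubleton_eq_iff)
    then have "gpath a b P" using that(2) gpath_sym[OF that(2)] by auto
    moreover have "a \<noteq> b" using that(1,3) by auto
    ultimately show ?thesis using that(4,5) unfolding that(1)[symmetric] by blast
  qed
  obtain x y P where P: "gpath x y P" "x \<noteq> y" "{x, y} \<notin> P" "C = insert {x, y} P"
    using assms(1) unfolding cyc_def by blast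
  show ?thesis
  proof (cases "{a, b} = {x, y}")
    case True
    then show ?thesis using turn[OF _ P] by simp
  next
    case False
    then have "{a, b} \<in> P" using assms P by auto
    from gpath_split_edge[OF P(1) this] obtain c d P1 P2 where *: "{a, b} = {c, d}"
      "P = insert {c, d} (P1 \<union> P2)" "gpath x c P1" "gpath d y P2"
      "insert x (\<Union>P1) \<inter> insert y (\<Union>P2) = {}" by (elim exE conjE)
    have cd: "c \<in> insert x (\<Union>P1)" "d \<in> insert y (\<Union>P2)"
      using gpath_ends[OF *(3)] gpath_ends[OF *(4)] by auto
    have "c \<notin> insert y (\<Union>P2)" "d \<notin> insert x (\<Union>P1)"
      using cd *(5) by blast+
    then have ne: "c \<noteq> d" "{c, d} \<notin> P1" "{c, d} \<notin> P2" using cd by auto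
    have "gpath c y (P1 \<union> {{x, y}})"
      by (rule gpath_append[OF gpath_sym[OF *(3)] gpath_edge[OF P(2)]])
        (use *(5) cd P(2) in auto)
    then have "gpath c d (P1 \<union> {{x, y}} \<union> P2)"
      by (rule gpath_append[OF _ gpath_sym[OF *(4)]]) (use *(5) cd P(2) in auto)
    then have 1: "gpath c d (insert {x, y} (P1 \<union> P2))" by simp
    have 2: "{c, d} \<notin> insert {x, y} (P1 \<union> P2)" using ne False *(1) by simp
    have 3: "C = insert {c, d} (insert {x, y} (P1 \<union> P2))"
      using P(4) *(2) by (simp only: insert_commute)
    show ?thesis by (rule turn[OF *(1) 1 ne(1) 2 3])
  qed
qed

lemma cyc_edge:
  assumes "cyc C" "e \<in> C"
  shows "\<exists>a b. e = {a, b} \<and> a \<noteq> b"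
proof -
  have "\<exists>a b. e = {a, b} \<and> a \<noteq> b" if "gpath x y P" "e \<in> P" for x y P
    using that by (induction rule: gpath.induct) auto
  then show ?thesis using assms unfolding cyc_def by blast
qed

lemma cyc_vertex:
  assumes "cyc C" "v \<in> \<Union>C"
  shows "\<exists>c d P. gpath c d P \<and> v \<notin> \<Union>P \<and> c \<noteq> d \<and> c \<noteq> v \<and> d \<noteq> v \<and> C = {{v, c}, {v, d}} \<union> P"
proof -
  obtain e where e: "e \<in> C" "v \<in> e" using assms(2) by blast
  obtain a b where "e = {a, b}" using cyc_edge[OF assms(1) e(1)] by blast
  with e obtain c where c: "{v, c} \<in> C" by (cases "v = a") (auto simp: insert_commute)
  from cyc_rotate[OF assms(1) c] obtain P where P: "gpath v c P" "v \<noteq> c" "{v, c} \<notin> P"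
    "C = insert {v, c} P" by (elim exE conjE)
  obtain d Q where Q: "P = insert {v, d} Q" "gpath d c Q" "v \<noteq> d" "v \<notin> \<Union>Q" "{v, d} \<notin> Q"
    using P(1,2) by (rule gpath_first)
  have "c \<noteq> d" using P(3) Q(1) by auto
  then show ?thesis using P Q gpath_sym[OF Q(2)]
    by - (rule exI[of _ c], rule exI[of _ d], rule exI[of _ Q], simp)
qed

lemma cyc_two_edges:
  assumes "gpath a b P" "a \<noteq> b" "v \<notin> \<Union>P" "v \<noteq> a" "v \<noteq> b"
  shows "cyc ({{v, a}, {v, b}} \<union> P)"
proof -
  have "gpath v b (insert {v, a} P)"
    using assms by (intro gpath.step) auto
  moreover have "{v, b} \<notin> insert {v, a} P" using assms by (auto simp: doubleton_eq_iff)
  ultimately have "cyc (insert {v, b} (insert {v, a} P))"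
    using assms by (intro cycI) auto
  then show ?thesis by (simp add: insert_commute)
qed

section \<open>Unique shortest paths and short cycles\<close>

text \<open>Strictness forbids ties with the minimum only; longer paths may tie with each
  other.\<close>

definition geo :: "'a set set \<Rightarrow> ('a set \<Rightarrow> nat) \<Rightarrow> 'a \<Rightarrow> 'a \<Rightarrow> 'a set set \<Rightarrow> bool" where
  "geo E W x y P \<longleftrightarrow> gpath x y P \<and> P \<subseteq> E \<and>
     (\<forall>Q. gpath x y Q \<and> Q \<subseteq> E \<and> Q \<noteq> P \<longrightarrow> sum W P < sum W Q)"

lemma geoD: "geo E W x y P \<Longrightarrow> gpath x y P" "geo E W x y P \<Longrightarrow> P \<subseteq> E"
  by (auto simp: geo_def)

lemma geo_less: "geo E W x y P \<Longrightarrow> gpath x y Q \<Longrightarrow> Q \<subseteq> E \<Longrightarrow> Q \<noteq> P \<Longrightarrow> sum W P < sum W Q"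
  by (auto simp: geo_def)

lemma geo_unique: "geo E W x y P \<Longrightarrow> geo E W x y Q \<Longrightarrow> P = Q"
  using geo_less geoD less_asym by metis

lemma geo_sym: "geo E W x y P \<Longrightarrow> geo E W y x P"
  unfolding geo_def using gpath_sym by metis

text \<open>Exchange: if \<open>Q\<close> were no heavier than the prefix \<open>P\<close>, some
  path inside \<open>Q \<union> R\<close> would be no heavier than the whole and hence equal to it.
  This puts \<open>P\<close> inside \<open>Q\<close>, and then they coincide. Weights may be zero,
  so a shortcut need not be strictly lighter; uniqueness does the work.\<close>

lemma geo_prefix:
  assumes g: "geo E W x z (P \<union> R)" and P: "gpath x y P" "gpath y z R" "P \<inter> R = {}"
  shows "geo E W x y P"
  unfolding geo_def
proof (intro conjI allI impI)
  show "gpath x y P" by (rule P)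
  show "P \<subseteq> E" using geoD(2)[OF g] by simp
  fix Q assume "gpath x y Q \<and> Q \<subseteq> E \<and> Q \<noteq> P"
  then have Q: "gpath x y Q" "Q \<subseteq> E" "Q \<noteq> P" by auto
  show "sum W P < sum W Q"
  proof (rule ccontr)
    assume "\<not> sum W P < sum W Q"
    then have le: "sum W Q \<le> sum W P" by simp
    obtain S where S: "S \<subseteq> Q \<union> R" "gpath x z S" using gpath_trans[OF Q(1) P(2)] by blast
    have fin: "finite Q" "finite R" "finite P"
      using gpath_finite[OF Q(1)] gpath_finite[OF P(1)] gpath_finite[OF P(2)] by auto
    have "sum W S \<le> sum W (Q \<union> R)" using S fin by (intro sum_mono2) auto
    also have "\<dots> \<le> sum W Q + sum W R" using fin by (simp add: sum_Un_nat)
    also have "\<dots> \<le> sum W P + sum W R" using le by simp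
    also have "\<dots> = sum W (P \<union> R)" using fin P(3) by (simp add: sum.union_disjoint)
    finally have "\<not> sum W (P \<union> R) < sum W S" by simp
    moreover have "S \<subseteq> E" using S(1) Q(2) geoD(2)[OF g] by blast
    ultimately have "S = P \<union> R" using geo_less[OF g S(2)] by blast
    then have "P \<subseteq> Q" using S(1) P(3) by blast
    then have "P = Q"
      using gpath_subpath_unique[OF Q(1) P(1) _ Q(1)] by blast
    then show False using Q(3) by simp
  qed
qed

lemma geo_suffix:
  assumes g: "geo E W x z (P \<union> R)" and P: "gpath x y P" "gpath y z R" "P \<inter> R = {}"
  shows "geo E W y z R"
proof -
  have "geo E W z x (R \<union> P)" using geo_sym[OF g] by (simp add: Un_commute)
  from geo_prefix[OF this gpath_sym[OF P(2)] gpath_sym[OF P(1)]] P(3)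
  show ?thesis using geo_sym by (metis Int_commute)
qed

lemma geo_between:
  assumes g: "geo E W x y P" and "u \<in> insert x (\<Union>P)" "v \<in> insert x (\<Union>P)"
  shows "\<exists>Q \<subseteq> P. geo E W u v Q"
proof -
  obtain P1 P2 where P: "P = P1 \<union> P2" "P1 \<inter> P2 = {}" "gpath x u P1" "gpath u y P2"
    "insert x (\<Union>P1) \<inter> insert y (\<Union>P2) = {u}"
    using gpath_split[OF geoD(1)[OF g] assms(2)] by (elim exE conjE)
  have g1: "geo E W x u P1" and g2: "geo E W u y P2"
    using geo_prefix[OF g[unfolded P(1)] P(3,4,2)] geo_suffix[OF g[unfolded P(1)] P(3,4,2)] .
  from assms(3) have "v \<in> insert x (\<Union>P1) \<or> v \<in> insert u (\<Union>P2)" unfolding P(1) by blast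
  then show ?thesis
  proof
    assume "v \<in> insert x (\<Union>P1)"
    from gpath_split[OF P(3) this] obtain R1 R2 where R: "P1 = R1 \<union> R2" "R1 \<inter> R2 = {}"
      "gpath x v R1" "gpath v u R2" by (elim exE conjE)
    from geo_suffix[OF g1[unfolded R(1)] R(3,4,2)] have "geo E W u v R2" by (rule geo_sym)
    then show ?thesis using P(1) R(1) by blast
  next
    assume "v \<in> insert u (\<Union>P2)"
    from gpath_split[OF P(4) this] obtain R1 R2 where R: "P2 = R1 \<union> R2" "R1 \<inter> R2 = {}"
      "gpath u v R1" "gpath v y R2" by (elim exE conjE)
    from geo_prefix[OF g2[unfolded R(1)] R(3,4,2)] have "geo E W u v R1" .
    then show ?thesis using P(1) R(1) by blast
  qed
qed

lemma geo_subpath: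
  assumes g: "geo E W x y P" and Q: "gpath u v Q" "Q \<subseteq> P"
  shows "geo E W u v Q"
proof (cases "u = v")
  case True
  then have "Q = {}" using Q(1) by simp
  then show ?thesis using True unfolding geo_def by auto
next
  case False
  then have "u \<in> insert x (\<Union>P)" "v \<in> insert x (\<Union>P)"
    using gpath_ends[OF Q(1)] Q(2) by auto
  from geo_between[OF g this] obtain R where R: "R \<subseteq> P" "geo E W u v R" by blast
  have "Q = R" by (rule gpath_subpath_unique[OF geoD(1)[OF g] Q geoD(1)[OF R(2)] R(1)])
  then show ?thesis using R(2) by simp
qed

section \<open>Short cycles and graphs with unique shortest paths\<close>

definition short :: "'a set set \<Rightarrow> ('a set \<Rightarrow> nat) \<Rightarrow> 'a set set \<Rightarrow> bool" where
  "short E W C \<longleftrightarrow> cyc C \<and> C \<subseteq> E \<and>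
     (\<forall>x \<in> \<Union>C. \<forall>y \<in> \<Union>C. \<forall>P. geo E W x y P \<longrightarrow> P \<subseteq> C)"

lemma shortD:
  assumes "short E W C"
  shows "cyc C" "C \<subseteq> E" "\<And>x y P. x \<in> \<Union>C \<Longrightarrow> y \<in> \<Union>C \<Longrightarrow> geo E W x y P \<Longrightarrow> P \<subseteq> C"
  using assms unfolding short_def by blast+

text \<open>Geodetic graphs are those with unique shortest paths. Connectedness is contained in the
  existence of \<open>P\<close>.\<close>

definition geodetic :: "'a set \<Rightarrow> 'a set set \<Rightarrow> ('a set \<Rightarrow> nat) \<Rightarrow> bool" where
  "geodetic V E W \<longleftrightarrow> finite V \<and> V \<noteq> {} \<and> (\<forall>e \<in> E. e \<subseteq> V \<and> card e = 2) \<and>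
     (\<forall>x \<in> V. \<forall>y \<in> V. \<exists>P. geo E W x y P)"

lemma geodeticD:
  assumes "geodetic V E W"
  shows "finite V" "V \<noteq> {}" "\<And>e. e \<in> E \<Longrightarrow> e \<subseteq> V" "\<And>e. e \<in> E \<Longrightarrow> card e = 2"
    "\<And>x y. x \<in> V \<Longrightarrow> y \<in> V \<Longrightarrow> \<exists>P. geo E W x y P" "finite E"
proof -
  show "finite E"
    by (rule finite_subset[of E "Pow V"]) (use assms in \<open>auto simp: geodetic_def\<close>)
qed (use assms in \<open>auto simp: geodetic_def\<close>)

lemma finite_short: "geodetic V E W \<Longrightarrow> finite {C. short E W C}"
  by (rule finite_subset[of _ "Pow E"]) (auto simp: short_def dest: geodeticD(6))

lemma geodetic_edge:
  assumes "geodetic V E W" "{a, b} \<in> E"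
  shows "a \<in> V" "b \<in> V" "a \<noteq> b"
  using geodeticD(3,4)[OF assms] by (auto simp: card_2_iff doubleton_eq_iff)

lemma geodetic_incident:
  assumes "geodetic V E W" "e \<in> E" "v \<in> e"
  obtains u where "e = {v, u}"
proof -
  obtain c d where "e = {c, d}" using geodeticD(4)[OF assms(1,2)] by (auto simp: card_2_iff)
  then show thesis using that[of c] that[of d] assms(3) by (auto simp: insert_commute)
qed

lemma geo_restrict:
  assumes "geo E W x y P" "P \<subseteq> E'" "E' \<subseteq> E"
  shows "geo E' W x y P"
  using assms unfolding geo_def by blast

text \<open>The common core of the three deletions below: if no shortest path between kept vertices
  uses a deleted edge, these paths stay the shortest ones, so shortness of a cycle of kept edges
  means the same before and after.\<close>

lemma geodetic_restrict:
  assumes G: "geodetic V E W" and V: "V' \<subseteq> V" "V' \<noteq> {}" and E: "E' \<subseteq> E" "\<Union>E' \<subseteq> V'"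
    and avoid: "\<And>x y P. x \<in> V' \<Longrightarrow> y \<in> V' \<Longrightarrow> geo E W x y P \<Longrightarrow> P \<subseteq> E'"
  shows "geodetic V' E' W" and "short E' W C \<longleftrightarrow> short E W C \<and> C \<subseteq> E'"
proof -
  have geo_iff: "geo E' W x y P \<longleftrightarrow> geo E W x y P" if xy: "x \<in> V'" "y \<in> V'" for x y P
  proof
    assume P: "geo E W x y P"
    show "geo E' W x y P" by (rule geo_restrict[OF P avoid[OF xy P] E(1)])
  next
    assume P: "geo E' W x y P"
    have "x \<in> V" "y \<in> V" using xy V(1) by auto
    then obtain Q where Q: "geo E W x y Q" using geodeticD(5)[OF G] by blast
    have "geo E' W x y Q" by (rule geo_restrict[OF Q avoid[OF xy Q] E(1)])
    then show "geo E W x y P" using geo_unique[OF P] Q by simp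
  qed
  show "geodetic V' E' W"
    unfolding geodetic_def
  proof (intro conjI ballI)
    show "finite V'" using geodeticD(1)[OF G] V(1) by (rule finite_subset[rotated])
    show "V' \<noteq> {}" by (rule V(2))
    show "e \<subseteq> V'" if "e \<in> E'" for e using that E(2) by blast
    show "card e = 2" if "e \<in> E'" for e using that E(1) geodeticD(4)[OF G] by blast
    show "\<exists>P. geo E' W x y P" if "x \<in> V'" "y \<in> V'" for x y
    proof -
      have "\<exists>P. geo E W x y P" using that V(1) by (intro geodeticD(5)[OF G]) auto
      then show ?thesis by (simp add: geo_iff[OF that])
    qed
  qed
  show "short E' W C \<longleftrightarrow> short E W C \<and> C \<subseteq> E'"
  proof (cases "C \<subseteq> E'")
    case True
    have "geo E' W x y P \<longleftrightarrow> geo E W x y P" if "x \<in> \<Union>C" "y \<in> \<Union>C" for x y P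
      by (rule geo_iff) (use that True E(2) in auto)
    then have "(\<forall>x \<in> \<Union>C. \<forall>y \<in> \<Union>C. \<forall>P. geo E' W x y P \<longrightarrow> P \<subseteq> C) \<longleftrightarrow>
        (\<forall>x \<in> \<Union>C. \<forall>y \<in> \<Union>C. \<forall>P. geo E W x y P \<longrightarrow> P \<subseteq> C)"
      by (intro ball_cong all_cong1 imp_cong HOL.refl)
    moreover have "C \<subseteq> E" using True E(1) by (rule subset_trans)
    ultimately show ?thesis using True unfolding short_def by simp
  next
    case False
    then show ?thesis unfolding short_def by blast
  qed
qed

section \<open>Deleting an edge or a vertex\<close>

lemma gpath_edge_avoid:
  assumes "gpath x y P" "P \<subseteq> E" "v \<noteq> x" "v \<noteq> y" "v \<in> \<Union>P"
  obtains c d where "c \<noteq> d" "{c, v} \<in> P" "{v, d} \<in> P" "gpath c d {{c, v}, {v, d}}"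
proof -
  from gpath_inner[OF assms(1,5,3,4)] obtain c d P1 P2 where *: "P = {{c, v}, {v, d}} \<union> (P1 \<union> P2)"
    "c \<noteq> d" "c \<noteq> v" "d \<noteq> v" by (elim exE conjE)
  have "gpath c d (insert {c, v} {{v, d}})"
    using *(2,3,4) by (intro gpath.step gpath_edge) auto
  then show thesis using that[of c d] * by simp
qed

lemma delete_edge:
  assumes G: "geodetic V E W" and e: "{a, b} \<in> E" and P0: "geo E W a b P0" "P0 \<noteq> {{a, b}}"
  shows "geodetic V (E - {{a, b}}) W"
    and "{C. short E W C} = insert (insert {a, b} P0) {C. short (E - {{a, b}}) W C}"
    and "\<not> short (E - {{a, b}}) W (insert {a, b} P0)"
proof -
  let ?E = "E - {{a, b}}"
  note ab = geodetic_edge[OF G e]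
  \<comment> \<open>A shortest path through \<open>{a, b}\<close> would contain this edge as a
    subpath, making the edge the shortest path between its ends instead of
    \<open>P0\<close>.\<close>
  have avoid: "P \<subseteq> ?E" if "geo E W x y P" for x y P
  proof -
    have "{a, b} \<notin> P"
    proof
      assume "{a, b} \<in> P"
      then have "geo E W a b {{a, b}}"
        using geo_subpath[OF that gpath_edge[OF ab(3)]] by blast
      then show False using geo_unique[OF P0(1)] P0(2) by blast
    qed
    then show ?thesis using geoD(2)[OF that] by blast
  qed
  have sub: "V \<subseteq> V" "?E \<subseteq> E" "\<Union>?E \<subseteq> V" using geodeticD(3)[OF G] by auto
  note R = geodetic_restrict[OF G sub(1) geodeticD(2)[OF G] sub(2,3)]
  show "geodetic V ?E W" by (rule R(1)) (rule avoid)
  have short_iff: "short ?E W C \<longleftrightarrow> short E W C \<and> C \<subseteq> ?E" for C by (rule R(2)) (rule avoid)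
  show "\<not> short ?E W (insert {a, b} P0)" unfolding short_def by blast
  have nP0: "{a, b} \<notin> P0" using avoid[OF P0(1)] by blast
  have ends: "a \<in> \<Union>P0" "b \<in> \<Union>P0" using gpath_ends[OF geoD(1)[OF P0(1)]] ab(3) by auto
  \<comment> \<open>The added edge brings no new vertex, and a shortest path between two vertices of
    \<open>P0\<close> is a piece of \<open>P0\<close>.\<close>
  have "short E W (insert {a, b} P0)"
    unfolding short_def
  proof (intro conjI ballI allI impI)
    show "cyc (insert {a, b} P0)" by (rule cycI[OF geoD(1)[OF P0(1)] ab(3) nP0])
    show "insert {a, b} P0 \<subseteq> E" using geoD(2)[OF P0(1)] e by simp
    fix x y P
    assume xy: "x \<in> \<Union>(insert {a, b} P0)" "y \<in> \<Union>(insert {a, b} P0)" and P: "geo E W x y P"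
    have "x \<in> insert a (\<Union>P0)" "y \<in> insert a (\<Union>P0)" using xy ends by auto
    from geo_between[OF P0(1) this] obtain Q where "Q \<subseteq> P0" "geo E W x y Q" by blast
    then show "P \<subseteq> insert {a, b} P0" using geo_unique[OF P] by blast
  qed
  moreover have "C = insert {a, b} P0" if C: "short E W C" "\<not> C \<subseteq> ?E" for C
  proof -
    have "{a, b} \<in> C" using C(2) shortD(2)[OF C(1)] by blast
    from cyc_rotate[OF shortD(1)[OF C(1)] this] obtain Q where Q: "gpath a b Q" "{a, b} \<notin> Q"
      "C = insert {a, b} Q" by (elim exE conjE)
    have "P0 \<subseteq> C" using shortD(3)[OF C(1) _ _ P0(1)] Q(3) by blast
    then have "P0 \<subseteq> Q" using nP0 Q(3) by blast
    then have "P0 = Q" by (rule gpath_subpath_unique[OF Q(1) geoD(1)[OF P0(1)] _ Q(1) subset_refl])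
    then show ?thesis using Q(3) by simp
  qed
  ultimately show "{C. short E W C} = insert (insert {a, b} P0) {C. short ?E W C}"
    using short_iff by blast
qed

text \<open>The hypothesis bounds the degree of \<open>v\<close> only from above. As there is
  another vertex, connectedness supplies the edge \<open>{v, a}\<close>, so exactly one edge
  disappears together with the vertex.\<close>

lemma delete_pendant:
  assumes G: "geodetic V E W" and v: "v \<in> V" "V \<noteq> {v}" and e: "\<And>u. {v, u} \<in> E \<Longrightarrow> u = a"
  shows "geodetic (V - {v}) (E - {{v, a}}) W" and "{v, a} \<in> E"
    and "{C. short E W C} = {C. short (E - {{v, a}}) W C}"
proof -
  obtain u where u: "u \<in> V" "u \<noteq> v" using v by blast
  then obtain P where P: "geo E W v u P" using geodeticD(5)[OF G v(1)] by blast
  obtain c Q where "P = insert {v, c} Q"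
    using geoD(1)[OF P] u(2) by (metis gpath_first)
  then have "{v, c} \<in> E" using geoD(2)[OF P] by blast
  then show "{v, a} \<in> E" using e by blast
  let ?E = "E - {{v, a}}"
  have edge: "f = {v, a}" if f: "f \<in> E" "v \<in> f" for f
  proof -
    obtain c where "f = {v, c}" using geodetic_incident[OF G f] .
    then show ?thesis using e f(1) by blast
  qed
  have avoid: "P \<subseteq> ?E" if xy: "x \<in> V - {v}" "y \<in> V - {v}" "geo E W x y P" for x y P
  proof -
    have "{v, a} \<notin> P"
    proof
      assume "{v, a} \<in> P"
      then have "v \<in> \<Union>P" by blast
      moreover have "v \<noteq> x" "v \<noteq> y" using xy by auto
      ultimately obtain c d where cd: "c \<noteq> d" "{c, v} \<in> P" "{v, d} \<in> P"
        using gpath_edge_avoid[OF geoD[OF xy(3)]] by metis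
      then have "{c, v} = {v, d}" using edge geoD(2)[OF xy(3)] by blast
      then show False using cd(1) by (auto simp: doubleton_eq_iff)
    qed
    then show ?thesis using geoD(2)[OF xy(3)] by blast
  qed
  have sub: "V - {v} \<subseteq> V" "V - {v} \<noteq> {}" "?E \<subseteq> E" "\<Union>?E \<subseteq> V - {v}"
    using u geodeticD(3)[OF G] edge by blast+
  note R = geodetic_restrict[OF G sub]
  show "geodetic (V - {v}) ?E W" by (rule R(1)) (rule avoid)
  have short_iff: "short ?E W C \<longleftrightarrow> short E W C \<and> C \<subseteq> ?E" for C by (rule R(2)) (rule avoid)
  have "C \<subseteq> ?E" if C: "short E W C" for C
  proof (rule ccontr)
    assume "\<not> C \<subseteq> ?E"
    then have "v \<in> \<Union>C" using shortD(2)[OF C] by blast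
    from cyc_vertex[OF shortD(1)[OF C] this] obtain c d P where
      cd: "c \<noteq> d" "c \<noteq> v" "d \<noteq> v" "C = {{v, c}, {v, d}} \<union> P" by (elim exE conjE)
    then have "{v, c} \<in> E" "{v, d} \<in> E" using shortD(2)[OF C] by auto
    then show False using e cd(1) by blast
  qed
  then show "{C. short E W C} = {C. short ?E W C}" using short_iff by blast
qed

lemma cyc_degree_two:
  assumes "cyc C" "v \<in> \<Union>C" "\<And>u. {v, u} \<in> C \<Longrightarrow> u = a \<or> u = b"
  obtains P where "gpath a b P" "v \<notin> \<Union>P" "C = {{v, a}, {v, b}} \<union> P" "a \<noteq> b" "v \<noteq> a" "v \<noteq> b"
proof -
  from cyc_vertex[OF assms(1,2)] obtain c d P where
    P: "gpath c d P" "v \<notin> \<Union>P" "c \<noteq> d" "c \<noteq> v" "d \<noteq> v" "C = {{v, c}, {v, d}} \<union> P"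
    by (elim exE conjE)
  have "(c = a \<or> c = b) \<and> (d = a \<or> d = b)" using assms(3) P(6) by blast
  then have "c = a \<and> d = b \<or> c = b \<and> d = a" using P(3) by blast
  then show thesis
  proof
    assume "c = a \<and> d = b"
    then show thesis using that[of P] P by simp
  next
    assume "c = b \<and> d = a"
    then show thesis using that[of P] P gpath_sym[OF P(1)] by (simp add: insert_commute)
  qed
qed

lemma geo_degree_two:
  assumes g: "geo E W v y Q" and "v \<noteq> y" "\<And>u. {v, u} \<in> E \<Longrightarrow> u = a \<or> u = b"
  obtains d R where "d = a \<or> d = b" "geo E W d y R" "Q = insert {v, d} R" "v \<notin> \<Union>R"
proof -
  obtain d R where R: "Q = insert {v, d} R" "gpath d y R" "v \<noteq> d" "v \<notin> \<Union>R"
    using geoD(1)[OF g] assms(2) by (metis gpath_first)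
  have "{v, d} \<in> E" using R(1) geoD(2)[OF g] by blast
  then show thesis using that[of d R] R assms(3) geo_subpath[OF g R(2)] by blast
qed

lemma delete_degree_two:
  assumes G: "geodetic V E W" and ab: "{v, a} \<in> E" "{v, b} \<in> E" "a \<noteq> b"
    and e: "\<And>u. {v, u} \<in> E \<Longrightarrow> u = a \<or> u = b"
    and P0: "geo E W a b P0" "v \<notin> \<Union>P0"
  defines "E' \<equiv> E - {{v, a}, {v, b}}" and "C0 \<equiv> {{v, a}, {v, b}} \<union> P0"
  shows "geodetic (V - {v}) E' W"
    and "{C. short E W C} = insert C0 {C. short E' W C}"
    and "\<not> short E' W C0"
proof -
  note va = geodetic_edge[OF G ab(1)]
  note vb = geodetic_edge[OF G ab(2)]
  have edge: "f = {v, a} \<or> f = {v, b}" if f: "f \<in> E" "v \<in> f" for f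
  proof -
    obtain c where "f = {v, c}" using geodetic_incident[OF G f] .
    then show ?thesis using e f(1) by blast
  qed
  \<comment> \<open>A shortest path with \<open>v\<close> inside contains a-v-b, which would then be
    the shortest path from \<open>a\<close> to \<open>b\<close>; but \<open>P0\<close> avoids
    \<open>v\<close>.\<close>
  have avoid: "P \<subseteq> E'" if xy: "x \<in> V - {v}" "y \<in> V - {v}" "geo E W x y P" for x y P
  proof -
    have "v \<notin> \<Union>P"
    proof
      assume "v \<in> \<Union>P"
      moreover have "v \<noteq> x" "v \<noteq> y" using xy by auto
      ultimately obtain c d where cd: "c \<noteq> d" "{c, v} \<in> P" "{v, d} \<in> P"
        "gpath c d {{c, v}, {v, d}}"
        using gpath_edge_avoid[OF geoD[OF xy(3)]] by metis
      have g: "geo E W c d {{c, v}, {v, d}}"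
        by (rule geo_subpath[OF xy(3) cd(4)]) (use cd in simp)
      have "{v, c} \<in> E" "{v, d} \<in> E"
        using cd geoD(2)[OF xy(3)] by (auto simp: insert_commute)
      then have "c = a \<or> c = b" "d = a \<or> d = b" using e by blast+
      then have "c = a \<and> d = b \<or> c = b \<and> d = a" using cd(1) by blast
      then have "geo E W a b {{c, v}, {v, d}}" using g geo_sym[OF g] by (elim disjE) simp_all
      then have "P0 = {{c, v}, {v, d}}" by (rule geo_unique[OF P0(1)])
      then show False using P0(2) by simp
    qed
    then show ?thesis using geoD(2)[OF xy(3)] unfolding E'_def by blast
  qed
  have sub: "V - {v} \<subseteq> V" "V - {v} \<noteq> {}" "E' \<subseteq> E" "\<Union>E' \<subseteq> V - {v}"
    unfolding E'_def using va geodeticD(3)[OF G] edge by blast+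
  note R = geodetic_restrict[OF G sub]
  show "geodetic (V - {v}) E' W" by (rule R(1)) (rule avoid)
  have short_iff: "short E' W C \<longleftrightarrow> short E W C \<and> C \<subseteq> E'" for C by (rule R(2)) (rule avoid)
  show "\<not> short E' W C0" unfolding short_def E'_def C0_def by blast
  have ends: "a \<in> \<Union>P0" "b \<in> \<Union>P0" using gpath_ends[OF geoD(1)[OF P0(1)]] ab(3) by auto
  have inner: "P \<subseteq> P0" if "x \<in> \<Union>P0" "y \<in> \<Union>P0" "geo E W x y P" for x y P
    using geo_between[OF P0(1), of x y] that geo_unique[OF that(3)] by blast
  \<comment> \<open>A shortest path from \<open>v\<close> goes first to \<open>a\<close> or
    \<open>b\<close>, both on \<open>P0\<close>, and continues as a shortest path between vertices
    of \<open>P0\<close>.\<close>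
  have outer: "P \<subseteq> C0" if y: "y \<in> \<Union>P0" and P: "geo E W v y P" for y P
  proof -
    have "v \<noteq> y" using y P0(2) by blast
    from P this e obtain d R where R: "d = a \<or> d = b" "geo E W d y R" "P = insert {v, d} R"
      by (rule geo_degree_two)
    have "R \<subseteq> P0" by (rule inner[OF _ y R(2)]) (use R(1) ends in auto)
    then show ?thesis using R(1,3) unfolding C0_def by blast
  qed
  have "short E W C0"
    unfolding short_def
  proof (intro conjI ballI allI impI)
    show "cyc C0" unfolding C0_def
      by (rule cyc_two_edges[OF geoD(1)[OF P0(1)] ab(3) P0(2) va(3) vb(3)])
    show "C0 \<subseteq> E" unfolding C0_def using geoD(2)[OF P0(1)] ab by simp
    fix x y P
    assume xy: "x \<in> \<Union>C0" "y \<in> \<Union>C0" and P: "geo E W x y P"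
    have xy: "x = v \<or> x \<in> \<Union>P0" "y = v \<or> y \<in> \<Union>P0" using xy ends unfolding C0_def by auto
    show "P \<subseteq> C0"
    proof (cases "x = v")
      case True
      then show ?thesis
        using xy(2) outer[of y P] P geoD(1)[OF P] by auto
    next
      case False
      then show ?thesis
        using xy outer[of x P] inner[of x y P] P geo_sym[OF P] unfolding C0_def by blast
    qed
  qed
  moreover have "C = C0" if C: "short E W C" "\<not> C \<subseteq> E'" for C
  proof -
    have "v \<in> \<Union>C" using C(2) shortD(2)[OF C(1)] unfolding E'_def by blast
    moreover have "u = a \<or> u = b" if "{v, u} \<in> C" for u using that e shortD(2)[OF C(1)] by blast
    ultimately obtain Q where Q: "gpath a b Q" "v \<notin> \<Union>Q" "C = {{v, a}, {v, b}} \<union> Q"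
      using cyc_degree_two[OF shortD(1)[OF C(1)]] by metis
    have "P0 \<subseteq> C" by (rule shortD(3)[OF C(1) _ _ P0(1)]) (use Q(3) in auto)
    then have "P0 \<subseteq> Q" using P0(2) Q(3) by blast
    then have "P0 = Q" by (rule gpath_subpath_unique[OF Q(1) geoD(1)[OF P0(1)] _ Q(1) subset_refl])
    then show ?thesis using Q(3) unfolding C0_def by simp
  qed
  ultimately show "{C. short E W C} = insert C0 {C. short E' W C}"
    using short_iff by blast
qed

section \<open>Series reduction\<close>

text \<open>\<open>ab_no_edge\<close> leaves room for the new edge. With \<open>{a, b}\<close>
  already present the two would collapse into one, and a path using the old edge would have no
  counterpart.\<close>

locale series_reduction =
  fixes V :: "'a set" and E :: "'a set set" and W :: "'a set \<Rightarrow> nat" and v a b :: 'a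
  assumes G: "geodetic V E W"
    and va_edge: "{v, a} \<in> E" and vb_edge: "{v, b} \<in> E" and a_neq_b: "a \<noteq> b"
    and ab_no_edge: "{a, b} \<notin> E"
    and nbrs: "\<And>u. {v, u} \<in> E \<Longrightarrow> u = a \<or> u = b"
begin

definition E' :: "'a set set" where "E' = insert {a, b} (E - {{v, a}, {v, b}})"

definition W' :: "'a set \<Rightarrow> nat" where "W' = W({a, b} := W {v, a} + W {v, b})"

text \<open>Undoes the contraction. Between ends other than \<open>v\<close> it is a weight
  preserving bijection from the paths in \<open>E'\<close> to those in \<open>E\<close>, since a
  path through \<open>v\<close> has to run along a-v-b.\<close>

definition expand :: "'a set set \<Rightarrow> 'a set set" where
  "expand P = (if {a, b} \<in> P then {{v, a}, {v, b}} \<union> (P - {{a, b}}) else P)"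

lemma neq: "v \<noteq> a" "v \<noteq> b" "a \<in> V" "b \<in> V" "v \<in> V"
  using geodetic_edge[OF G va_edge] geodetic_edge[OF G vb_edge] by auto

lemma v_edge:
  assumes "f \<in> E" "v \<in> f"
  shows "f = {v, a} \<or> f = {v, b}"
proof -
  obtain c where "f = {v, c}" using geodetic_incident[OF G assms] .
  then show ?thesis using nbrs assms(1) by blast
qed

lemma v_notin_E': "v \<notin> \<Union>E'"
  using v_edge neq(1,2) unfolding E'_def by auto

lemma v_edges_notin: "P \<subseteq> E' \<Longrightarrow> {v, a} \<notin> P" "P \<subseteq> E' \<Longrightarrow> {v, b} \<notin> P"
  using v_notin_E' by auto

lemma expand_subset_E: "P \<subseteq> E' \<Longrightarrow> expand P \<subseteq> E"
  using va_edge vb_edge unfolding expand_def E'_def by auto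

lemma expand_subset_iff:
  assumes "P \<subseteq> E'" "Q \<subseteq> E'"
  shows "expand P \<subseteq> expand Q \<longleftrightarrow> P \<subseteq> Q"
  using v_edges_notin[OF assms(1)] v_edges_notin[OF assms(2)] neq(1,2)
  unfolding expand_def by (auto simp: doubleton_eq_iff)

lemma expand_inj: "inj_on expand (Pow E')"
  by (rule inj_onI) (use expand_subset_iff in \<open>simp add: subset_antisym set_eq_subset\<close>)

lemma Union_expand: "\<Union>P \<subseteq> \<Union>(expand P)" "\<Union>(expand P) \<subseteq> insert v (\<Union>P)"
  unfolding expand_def by auto

lemma sum_expand:
  assumes "finite P" "P \<subseteq> E'"
  shows "sum W (expand P) = sum W' P"
proof (cases "{a, b} \<in> P")
  case True
  let ?P = "P - {{a, b}}"
  have P: "{v, a} \<notin> ?P" "{v, b} \<notin> ?P" "{v, a} \<noteq> {v, b}"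
    using v_edges_notin[OF assms(2)] a_neq_b by (auto simp: doubleton_eq_iff)
  have "sum W (expand P) = W {v, a} + (W {v, b} + sum W ?P)"
    using P assms(1) True unfolding expand_def by simp
  also have "sum W ?P = sum W' ?P" unfolding W'_def by (intro sum.cong) auto
  finally show ?thesis
    using sum.remove[OF assms(1) True, of W'] by (simp add: W'_def)
next
  case False
  then have "sum W' P = sum W P" unfolding W'_def by (intro sum.cong) auto
  then show ?thesis using False unfolding expand_def by simp
qed

lemma gpath_expand:
  assumes "gpath x y P" "P \<subseteq> E'" "x \<noteq> v" "y \<noteq> v"
  shows "gpath x y (expand P)"
proof (cases "{a, b} \<in> P")
  case True
  from gpath_split_edge[OF assms(1) True] obtain c d P1 P2 where P: "{a, b} = {c, d}"
    "P = insert {c, d} (P1 \<union> P2)" "gpath x c P1" "gpath d y P2"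
    "insert x (\<Union>P1) \<inter> insert y (\<Union>P2) = {}" by (elim exE conjE)
  have v: "v \<notin> insert x (\<Union>P1)" "v \<notin> insert y (\<Union>P2)"
    using v_notin_E' assms(2-4) P(2) by auto
  have "c \<in> insert x (\<Union>P1)" "d \<in> insert y (\<Union>P2)"
    using gpath_ends[OF P(3)] gpath_ends[OF P(4)] by auto
  then have cd: "c \<notin> insert y (\<Union>P2)" "d \<notin> insert x (\<Union>P1)" "c \<noteq> v" "d \<noteq> v"
    using P(5) v by auto
  then have nin: "{c, d} \<notin> P1" "{c, d} \<notin> P2" by auto
  have "c \<noteq> d" using P(1) a_neq_b by auto
  have "gpath v y (insert {v, d} P2)"
    by (rule gpath.step[OF P(4)]) (use cd(4) v(2) in auto)
  then have "gpath c y (insert {c, v} (insert {v, d} P2))"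
    by (rule gpath.step) (use cd \<open>c \<noteq> d\<close> in auto)
  then have "gpath x y (P1 \<union> insert {c, v} (insert {v, d} P2))"
    by (rule gpath_append[OF P(3)]) (use P(5) cd v in auto)
  moreover have "{{v, a}, {v, b}} = {{c, v}, {v, d}}"
    using P(1) by (auto simp: doubleton_eq_iff)
  then have "P1 \<union> insert {c, v} (insert {v, d} P2) = expand P"
    using nin P(1,2) unfolding expand_def by auto
  ultimately show ?thesis by simp
next
  case False
  then show ?thesis using assms(1) unfolding expand_def by simp
qed

lemma gpath_contract:
  assumes "gpath x y Q" "Q \<subseteq> E" "x \<noteq> v" "y \<noteq> v"
  obtains P where "gpath x y P" "P \<subseteq> E'" "Q = expand P"
proof (cases "v \<in> \<Union>Q")
  case True
  from gpath_inner[OF assms(1) this assms(3,4)[symmetric]] obtain c d P1 P2 where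
    Q: "Q = {{c, v}, {v, d}} \<union> (P1 \<union> P2)" "gpath x c P1" "gpath d y P2"
      "insert x (\<Union>P1) \<inter> insert y (\<Union>P2) = {}" "v \<notin> \<Union>P1" "v \<notin> \<Union>P2"
      "c \<noteq> d" by (elim exE conjE)
  have "{v, c} \<in> E" "{v, d} \<in> E" using Q(1) assms(2) by (auto simp: insert_commute)
  then have "c = a \<or> c = b" "d = a \<or> d = b" using nbrs by blast+
  then have cd: "{c, d} = {a, b}" and vcd: "{{c, v}, {v, d}} = {{v, a}, {v, b}}"
    using Q(7) by auto
  have tip: "c \<in> insert x (\<Union>P1)" "d \<in> insert y (\<Union>P2)"
    using gpath_ends[OF Q(2)] gpath_ends[OF Q(3)] by auto
  then have "c \<notin> insert y (\<Union>P2)" "d \<notin> insert x (\<Union>P1)" using Q(4) by auto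
  then have "gpath c y (insert {c, d} P2)"
    using Q(3,7) by (intro gpath.step) auto
  then have path: "gpath x y (P1 \<union> insert {c, d} P2)"
    by (rule gpath_append[OF Q(2)]) (use Q(4) tip \<open>d \<notin> insert x (\<Union>P1)\<close> in auto)
  have E: "P1 \<subseteq> E - {{v, a}, {v, b}}" "P2 \<subseteq> E - {{v, a}, {v, b}}"
    using Q(1,5,6) assms(2) by auto
  have "{a, b} \<notin> P1" "{a, b} \<notin> P2" using E ab_no_edge by auto
  then have "Q = expand (P1 \<union> insert {c, d} P2)"
    using Q(1) cd vcd unfolding expand_def by auto
  moreover have "P1 \<union> insert {c, d} P2 \<subseteq> E'"
    using E cd unfolding E'_def by auto
  ultimately show thesis using that path by blast
next
  case False
  then have "Q \<subseteq> E'" "{a, b} \<notin> Q" using assms(2) ab_no_edge unfolding E'_def by auto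
  then show thesis using that[of Q] assms(1) unfolding expand_def by simp
qed

lemma gpath_expand_iff:
  assumes "P \<subseteq> E'" "x \<noteq> v" "y \<noteq> v"
  shows "gpath x y (expand P) \<longleftrightarrow> gpath x y P"
proof
  assume "gpath x y (expand P)"
  then obtain R where R: "gpath x y R" "R \<subseteq> E'" "expand P = expand R"
    using gpath_contract[OF _ expand_subset_E[OF assms(1)] assms(2,3)] by metis
  then have "P = R" using inj_onD[OF expand_inj R(3)] assms(1) by simp
  then show "gpath x y P" using R(1) by simp
qed (rule gpath_expand[OF _ assms])

text \<open>The bijection on paths preserves weights, so a unique minimum on one side is one on the
  other.\<close>

lemma geo_expand_iff:
  assumes "P \<subseteq> E'" "x \<noteq> v" "y \<noteq> v"
  shows "geo E W x y (expand P) \<longleftrightarrow> geo E' W' x y P"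
proof -
  have sums: "sum W (expand Q) = sum W' Q" if "gpath x y Q" "Q \<subseteq> E'" for Q
    using sum_expand gpath_finite[OF that(1)] that(2) by blast
  show ?thesis
  proof
    assume g: "geo E W x y (expand P)"
    then have P: "gpath x y P" using gpath_expand_iff[OF assms] geoD(1)[OF g] by simp
    show "geo E' W' x y P"
      unfolding geo_def
    proof (intro conjI allI impI P assms(1))
      fix Q assume Q: "gpath x y Q \<and> Q \<subseteq> E' \<and> Q \<noteq> P"
      then have "expand Q \<noteq> expand P" using inj_onD[OF expand_inj, of Q P] assms(1) by auto
      then have "sum W (expand P) < sum W (expand Q)"
        using geo_less[OF g] gpath_expand[OF _ _ assms(2,3)] expand_subset_E Q by blast
      then show "sum W' P < sum W' Q" using sums P assms(1) Q by simp
    qed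
  next
    assume g: "geo E' W' x y P"
    note P = geoD(1)[OF g]
    show "geo E W x y (expand P)"
      unfolding geo_def
    proof (intro conjI allI impI gpath_expand[OF P assms] expand_subset_E[OF assms(1)])
      fix Q assume Q: "gpath x y Q \<and> Q \<subseteq> E \<and> Q \<noteq> expand P"
      then obtain R where R: "gpath x y R" "R \<subseteq> E'" "Q = expand R"
        using gpath_contract[OF _ _ assms(2,3)] by metis
      then have "sum W' P < sum W' R" using geo_less[OF g R(1,2)] Q by blast
      then show "sum W (expand P) < sum W Q" using sums P assms(1) R by simp
    qed
  qed
qed

lemma geodetic_reduced: "geodetic (V - {v}) E' W'"
  unfolding geodetic_def
proof (intro conjI ballI)
  show "finite (V - {v})" using geodeticD(1)[OF G] by simp
  show "V - {v} \<noteq> {}" using neq by auto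
  show "e \<subseteq> V - {v}" if "e \<in> E'" for e
    using that v_notin_E' geodeticD(3)[OF G] neq unfolding E'_def by auto
  show "card e = 2" if "e \<in> E'" for e
    using that geodeticD(4)[OF G] a_neq_b unfolding E'_def by (auto simp: card_2_iff)
  fix x y assume xy: "x \<in> V - {v}" "y \<in> V - {v}"
  then have "x \<in> V" "y \<in> V" "x \<noteq> v" "y \<noteq> v" by auto
  then obtain Q where Q: "geo E W x y Q" using geodeticD(5)[OF G] by blast
  obtain P where "P \<subseteq> E'" "Q = expand P"
    using gpath_contract[OF geoD[OF Q] \<open>x \<noteq> v\<close> \<open>y \<noteq> v\<close>] by metis
  then show "\<exists>P. geo E' W' x y P"
    using geo_expand_iff[OF _ \<open>x \<noteq> v\<close> \<open>y \<noteq> v\<close>] Q by blast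
qed

lemma cyc_expand:
  assumes "cyc C" "C \<subseteq> E'"
  shows "cyc (expand C)"
proof (cases "{a, b} \<in> C")
  case True
  from cyc_rotate[OF assms(1) True] obtain P where P: "gpath a b P" "{a, b} \<notin> P"
    "C = insert {a, b} P" by (elim exE conjE)
  have "v \<notin> \<Union>P" using v_notin_E' assms(2) P(3) by auto
  from cyc_two_edges[OF P(1) a_neq_b this neq(1,2)] show ?thesis
    using P(2,3) unfolding expand_def by simp
next
  case False
  then show ?thesis using assms(1) unfolding expand_def by simp
qed

lemma cyc_contract:
  assumes "cyc D" "D \<subseteq> E"
  obtains C where "cyc C" "C \<subseteq> E'" "D = expand C"
proof (cases "v \<in> \<Union>D")
  case True
  obtain P where P: "gpath a b P" "v \<notin> \<Union>P" "D = {{v, a}, {v, b}} \<union> P"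
    using cyc_degree_two[OF assms(1) True] nbrs assms(2) by (metis subsetD)
  have "{a, b} \<notin> P" using ab_no_edge P(3) assms(2) by auto
  then have "cyc (insert {a, b} P)" by (rule cycI[OF P(1) a_neq_b])
  moreover have "insert {a, b} P \<subseteq> E'" using P(2,3) assms(2) unfolding E'_def by auto
  moreover have "D = expand (insert {a, b} P)"
    using P(3) \<open>{a, b} \<notin> P\<close> unfolding expand_def by simp
  ultimately show thesis by (rule that)
next
  case False
  then have "D \<subseteq> E'" "{a, b} \<notin> D" using assms(2) ab_no_edge unfolding E'_def by auto
  then show thesis using that[of D] assms(1) unfolding expand_def by simp
qed

lemma short_expand:
  assumes "short E' W' C"
  shows "short E W (expand C)"
proof -
  note C = shortD[OF assms]
  have inner: "Q \<subseteq> expand C" if "x \<in> \<Union>C" "y \<in> \<Union>C" and Q: "geo E W x y Q" for x y Q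
  proof -
    have xy: "x \<noteq> v" "y \<noteq> v" using that(1,2) C(2) v_notin_E' by auto
    obtain P where P: "P \<subseteq> E'" "Q = expand P"
      using gpath_contract[OF geoD[OF Q] xy] by metis
    then have "geo E' W' x y P" using geo_expand_iff[OF _ xy] Q by simp
    with C(3)[OF that(1,2)] have "P \<subseteq> C" by blast
    then show ?thesis using expand_subset_iff[OF P(1) C(2)] P(2) by simp
  qed
  \<comment> \<open>\<open>v\<close> is on the expanded cycle only if \<open>{a, b} \<in> C\<close>.
    A shortest path from \<open>v\<close> then starts towards \<open>a\<close> or \<open>b\<close>,
    both on \<open>C\<close>, and the rest falls under \<open>inner\<close>.\<close>
  have outer: "Q \<subseteq> expand C" if v: "v \<in> \<Union>(expand C)" and y: "y \<in> \<Union>C" and Q: "geo E W v y Q" for y Q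
  proof -
    have "v \<noteq> y" using y C(2) v_notin_E' by auto
    from Q this nbrs obtain d R where R: "d = a \<or> d = b" "geo E W d y R" "Q = insert {v, d} R"
      by (rule geo_degree_two)
    have ab: "{a, b} \<in> C" using v C(2) v_notin_E' unfolding expand_def by (auto split: if_splits)
    then have "d \<in> \<Union>C" "{v, d} \<in> expand C" using R(1) unfolding expand_def by auto
    then show ?thesis using inner[OF _ y R(2)] R(3) by simp
  qed
  show ?thesis
    unfolding short_def
  proof (intro conjI ballI allI impI cyc_expand expand_subset_E C(1,2))
    fix x y Q assume xy: "x \<in> \<Union>(expand C)" "y \<in> \<Union>(expand C)" and Q: "geo E W x y Q"
    have xy': "x = v \<or> x \<in> \<Union>C" "y = v \<or> y \<in> \<Union>C" using xy Union_expand(2) by auto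
    show "Q \<subseteq> expand C"
    proof (cases "x = v")
      case True
      then show ?thesis using xy xy' outer Q geoD(1)[OF Q] by (cases "y = v") auto
    next
      case False
      then show ?thesis
        using xy xy' outer[OF _ _ geo_sym] inner Q by (cases "y = v") auto
    qed
  qed
qed

lemma short_contract:
  assumes "short E W (expand C)" "cyc C" "C \<subseteq> E'"
  shows "short E' W' C"
  unfolding short_def
proof (intro conjI ballI allI impI assms)
  fix x y P assume xy: "x \<in> \<Union>C" "y \<in> \<Union>C" and P: "geo E' W' x y P"
  have "x \<noteq> v" "y \<noteq> v" using xy assms(3) v_notin_E' by auto
  then have "geo E W x y (expand P)" using geo_expand_iff[OF geoD(2)[OF P]] P by simp
  then have "expand P \<subseteq> expand C"
    using shortD(3)[OF assms(1)] xy Union_expand(1)[of C] by blast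
  then show "P \<subseteq> C" using expand_subset_iff[OF geoD(2)[OF P] assms(3)] by simp
qed

lemma card_short_reduced: "card {C. short E W C} = card {C. short E' W' C}"
proof -
  have "{C. short E W C} = expand ` {C. short E' W' C}"
  proof (intro equalityI subsetI)
    fix D assume "D \<in> {C. short E W C}"
    then have D: "short E W D" by simp
    obtain C where "cyc C" "C \<subseteq> E'" "D = expand C"
      using cyc_contract[OF shortD(1,2)[OF D]] by metis
    then show "D \<in> expand ` {C. short E' W' C}" using short_contract D by blast
  qed (use short_expand in blast)
  moreover have "inj_on expand {C. short E' W' C}"
    by (rule inj_on_subset[OF expand_inj]) (auto dest: shortD(2))
  ultimately show ?thesis by (simp add: card_image)
qed

end

section \<open>Induction along the 2-tree\<close>

text \<open>The count m - n + 1 with the subtraction moved across, since it truncates on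
  \<open>nat\<close>.\<close>

definition cyclomatic :: "'a set \<Rightarrow> 'a set set \<Rightarrow> ('a set \<Rightarrow> nat) \<Rightarrow> bool" where
  "cyclomatic V E W \<longleftrightarrow> card {C. short E W C} + card V = card E + 1"

text \<open>Two edges give way to one and one vertex is lost, so edges minus vertices is invariant,
  as is the number of short cycles.\<close>

lemma (in series_reduction) cyclomatic_reduced:
  assumes "cyclomatic (V - {v}) E' W'"
  shows "cyclomatic V E W"
proof -
  have fin: "finite E" "finite V" using geodeticD[OF G] by auto
  have "{v, a} \<noteq> {v, b}" using a_neq_b by (auto simp: doubleton_eq_iff)
  then have "card {{v, a}, {v, b}} = 2" by simp
  moreover have "{{v, a}, {v, b}} \<subseteq> E" using va_edge vb_edge by simp
  ultimately have "card (E - {{v, a}, {v, b}}) = card E - 2" "2 \<le> card E"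
    using fin card_mono[of E "{{v, a}, {v, b}}"] by (simp_all only: card_Diff_subset finite.intros)
  moreover have "card E' = Suc (card (E - {{v, a}, {v, b}}))"
    unfolding E'_def using fin ab_no_edge by (intro card_insert_disjoint) auto
  moreover have "card V = Suc (card (V - {v}))" using fin neq(5) by (metis card_Suc_Diff1)
  ultimately show ?thesis
    using assms card_short_reduced unfolding cyclomatic_def by simp
qed

text \<open>\<open>IH\<close> covers just the graphs that the reductions produce: edges away from
  \<open>v\<close> and at most one further edge, which joins two neighbours of \<open>v\<close>.
  This keeps them inside the smaller 2-tree. The weights are free because a contraction changes
  them.\<close>

lemma cyclomatic_vertex:
  assumes G: "geodetic V E W" and v: "v \<in> V" and nbrs: "\<And>u. {v, u} \<in> E \<Longrightarrow> u = a \<or> u = b"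
    and IH: "\<And>E' W'. geodetic (V - {v}) E' W' \<Longrightarrow>
      E' \<subseteq> {e \<in> E. v \<notin> e} \<or>
      (\<exists>x y. x \<noteq> y \<and> {v, x} \<in> E \<and> {v, y} \<in> E \<and> E' \<subseteq> insert {x, y} {e \<in> E. v \<notin> e}) \<Longrightarrow>
      cyclomatic (V - {v}) E' W'"
  shows "cyclomatic V E W"
proof -
  have fin: "finite E" "finite V" using geodeticD[OF G] by auto
  have cardV: "card V = Suc (card (V - {v}))" using fin v by (metis card_Suc_Diff1)
  \<comment> \<open>\<open>a\<close> and \<open>b\<close> need not be neighbours of
    \<open>v\<close>, nor distinct; the cases go by the neighbours that \<open>v\<close> really
    has.\<close>
  consider (single) "V = {v}" | (pendant) c where "V \<noteq> {v}" "\<And>u. {v, u} \<in> E \<Longrightarrow> u = c"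
    | (two) "a \<noteq> b" "{v, a} \<in> E" "{v, b} \<in> E"
    using nbrs by metis
  then show ?thesis
  proof cases
    case single
    have "E = {}"
    proof (rule ccontr)
      assume "E \<noteq> {}"
      then obtain e where "e \<in> E" by blast
      then have "card e = 2" "e \<subseteq> {v}" using geodeticD(3,4)[OF G] single by auto
      then show False using card_mono[of "{v}" e] by simp
    qed
    moreover have "C = {}" "cyc C" if "short {} W C" for C using shortD[OF that] by auto
    then have "{C. short {} W C} = {}" unfolding cyc_def by blast
    then have "card {C. short {} W C} = 0" by (simp only: card.empty)
    ultimately show ?thesis using single unfolding cyclomatic_def by simp
  next
    case pendant
    note D = delete_pendant[OF G v pendant(1) pendant(2)]
    have "E - {{v, c}} \<subseteq> {e \<in> E. v \<notin> e}"
    proof (intro subsetI CollectI conjI notI)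
      fix e assume e: "e \<in> E - {{v, c}}"
      then show "e \<in> E" by simp
      assume "v \<in> e"
      with e obtain u where "e = {v, u}" using geodetic_incident[OF G] by blast
      then show False using e pendant(2)[of u] by auto
    qed
    then have "cyclomatic (V - {v}) (E - {{v, c}}) W" using IH[OF D(1)] by blast
    moreover have "card E = Suc (card (E - {{v, c}}))" using D(2) fin by (metis card_Suc_Diff1)
    ultimately show ?thesis using D(3) cardV unfolding cyclomatic_def by simp
  next
    case two
    have va: "a \<in> V" "b \<in> V" "v \<noteq> a" "v \<noteq> b"
      using geodetic_edge[OF G two(2)] geodetic_edge[OF G two(3)] by auto
    have rest: "E - {{v, a}, {v, b}} \<subseteq> {e \<in> E. v \<notin> e}"
    proof (intro subsetI CollectI conjI notI)
      fix e assume e: "e \<in> E - {{v, a}, {v, b}}"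
      then show "e \<in> E" by simp
      assume "v \<in> e"
      with e obtain u where "e = {v, u}" using geodetic_incident[OF G] by blast
      then show False using e nbrs[of u] by auto
    qed
    obtain P0 where P0: "geo E W a b P0" using geodeticD(5)[OF G va(1,2)] by blast
    show ?thesis
    proof (cases "v \<in> \<Union>P0")
      case False
      let ?E = "E - {{v, a}, {v, b}}"
      note D = delete_degree_two[OF G two(2,3,1) nbrs P0 False]
      have "cyclomatic (V - {v}) ?E W" using IH[OF D(1)] rest by blast
      moreover have "card {C. short E W C} = Suc (card {C. short ?E W C})"
        using D(2,3) finite_short[OF D(1)] by simp
      moreover have "{v, a} \<noteq> {v, b}" using two(1) by (auto simp: doubleton_eq_iff)
      then have "card {{v, a}, {v, b}} = 2" by simp
      then have "card ?E = card E - 2" "2 \<le> card E"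
        using two fin card_mono[of E "{{v, a}, {v, b}}"] by (simp_all add: card_Diff_subset)
      ultimately show ?thesis using cardV unfolding cyclomatic_def by simp
    next
      case True
      then have neP0: "P0 \<noteq> {{a, b}}" using va by auto
      show ?thesis
      proof (cases "{a, b} \<in> E")
        case True
        \<comment> \<open>The deletion accounts for one cycle and one edge and makes room for the
          contraction, which puts \<open>{a, b}\<close> back with the weight of a-v-b.\<close>
        note D = delete_edge[OF G True P0 neP0]
        interpret series_reduction V "E - {{a, b}}" W v a b
          by unfold_locales (use D(1) two nbrs va in \<open>auto simp: doubleton_eq_iff\<close>)
        have "E' \<subseteq> insert {a, b} {e \<in> E. v \<notin> e}" using rest unfolding E'_def by auto
        then have "cyclomatic (V - {v}) E' W'" using IH[OF geodetic_reduced] two by blast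
        then have "cyclomatic V (E - {{a, b}}) W" by (rule cyclomatic_reduced)
        moreover have "card {C. short E W C} = Suc (card {C. short (E - {{a, b}}) W C})"
          using D(2,3) finite_short[OF D(1)] by simp
        moreover have "card E = Suc (card (E - {{a, b}}))" using True fin by (metis card_Suc_Diff1)
        ultimately show ?thesis unfolding cyclomatic_def by simp
      next
        case False
        interpret series_reduction V E W v a b
          by unfold_locales (use G two nbrs False in auto)
        have "E' \<subseteq> insert {a, b} {e \<in> E. v \<notin> e}" using rest unfolding E'_def by auto
        then have "cyclomatic (V - {v}) E' W'" using IH[OF geodetic_reduced] two by blast
        then show ?thesis by (rule cyclomatic_reduced)
      qed
    qed
  qed
qed

text \<open>All subgraphs and weights at once, for a fixed \<open>f\<close>: the last vertex of the
  2-tree may have no preimage, and contractions change both edges and weights.\<close>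

definition cyclomatic_below :: "('a \<Rightarrow> 'b) \<Rightarrow> 'b set \<Rightarrow> 'b set set \<Rightarrow> bool" where
  "cyclomatic_below f N F \<longleftrightarrow> (\<forall>V E W. geodetic V E W \<and> inj_on f V \<and> f ` V \<subseteq> N \<and> (`) f ` E \<subseteq> F \<longrightarrow>
     cyclomatic V E W)"

lemma cyclomatic_belowD:
  assumes "cyclomatic_below f N F" "geodetic V E W" "inj_on f V" "f ` V \<subseteq> N" "(`) f ` E \<subseteq> F"
  shows "cyclomatic V E W"
  using assms unfolding cyclomatic_below_def by simp

text \<open>The option \<open>a = b\<close> admits a new vertex with one neighbour, so that the
  triangle itself can be grown from the empty graph. A contraction adds an edge between two distinct
  neighbours; their images are \<open>a\<close> and \<open>b\<close>, and
  \<open>{a, b} \<in> F\<close> absorbs it.\<close>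

lemma cyclomatic_below_extend:
  assumes below: "cyclomatic_below f N F" and F: "\<And>e. e \<in> F \<Longrightarrow> e \<subseteq> N" and v: "v \<notin> N"
    and ab: "{a, b} \<in> F \<or> a = b"
  shows "cyclomatic_below f (insert v N) (F \<union> {{v, a}, {v, b}})"
  unfolding cyclomatic_below_def
proof (intro allI impI, elim conjE)
  fix V E W
  assume G: "geodetic V E W" and inj: "inj_on f V" and fV: "f ` V \<subseteq> insert v N"
    and fE: "(`) f ` E \<subseteq> F \<union> {{v, a}, {v, b}}"
  show "cyclomatic V E W"
  proof (cases "v \<in> f ` V")
    case False
    have "(`) f ` E \<subseteq> F"
    proof
      fix d assume d: "d \<in> (`) f ` E"
      then have "v \<notin> d" using False geodeticD(3)[OF G] by blast
      then show "d \<in> F" using d fE by blast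
    qed
    moreover have "f ` V \<subseteq> N" using False fV by blast
    ultimately show ?thesis by (intro cyclomatic_belowD[OF below G inj])
  next
    case True
    then obtain x where x: "x \<in> V" "v = f x" by blast
    have only_x: "u = x" if "u \<in> V" "f u = v" for u
      using inj_onD[OF inj, of u x] that x by simp
    have nbr: "u \<in> V \<and> (f u = a \<or> f u = b)" if "{x, u} \<in> E" for u
    proof -
      have "f ` {x, u} \<in> F \<union> {{v, a}, {v, b}}" using that fE by blast
      then have "{v, f u} \<in> F \<union> {{v, a}, {v, b}}" using x(2) by simp
      moreover have "{v, f u} \<notin> F" using F v by blast
      ultimately have "{v, f u} = {v, a} \<or> {v, f u} = {v, b}" by blast
      then show ?thesis
        using geodetic_edge(2)[OF G that] by (auto simp: doubleton_eq_iff)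
    qed
    show ?thesis
    proof (rule cyclomatic_vertex[OF G x(1)])
      \<comment> \<open>If \<open>a\<close> has no preimage in \<open>V\<close>, its
        \<open>inv_into\<close> is arbitrary, but then no neighbour of \<open>x\<close> is mapped to
        \<open>a\<close>; likewise for \<open>b\<close>.\<close>
      show "u = inv_into V f a \<or> u = inv_into V f b" if "{x, u} \<in> E" for u
        using nbr[OF that] inv_into_f_f[OF inj] by metis
      fix E' W'
      assume G': "geodetic (V - {x}) E' W'"
        and E': "E' \<subseteq> {e \<in> E. x \<notin> e} \<or>
          (\<exists>y z. y \<noteq> z \<and> {x, y} \<in> E \<and> {x, z} \<in> E \<and> E' \<subseteq> insert {y, z} {e \<in> E. x \<notin> e})"
      have old: "f ` e \<in> F" if e: "e \<in> E" "x \<notin> e" for e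
      proof -
        have "v \<notin> f ` e"
          using e(2) only_x geodeticD(3)[OF G e(1)] by blast
        then show ?thesis using fE e(1) by blast
      qed
      have "(`) f ` E' \<subseteq> F"
        using E'
      proof
        assume "E' \<subseteq> {e \<in> E. x \<notin> e}"
        then show ?thesis using old by blast
      next
        assume "\<exists>y z. y \<noteq> z \<and> {x, y} \<in> E \<and> {x, z} \<in> E \<and> E' \<subseteq> insert {y, z} {e \<in> E. x \<notin> e}"
        then obtain y z where yz: "y \<noteq> z" "{x, y} \<in> E" "{x, z} \<in> E"
          "E' \<subseteq> insert {y, z} {e \<in> E. x \<notin> e}" by blast
        have "f y \<noteq> f z" using inj_onD[OF inj, of y z] nbr[OF yz(2)] nbr[OF yz(3)] yz(1) by blast
        then have "f ` {y, z} = {a, b}" "a \<noteq> b" using nbr[OF yz(2)] nbr[OF yz(3)] by auto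
        then have "f ` {y, z} \<in> F" using ab by (simp only: simp_thms)
        then show ?thesis using old yz(4) by blast
      qed
      moreover have "f ` (V - {x}) \<subseteq> N"
        using fV only_x by blast
      moreover have "inj_on f (V - {x})" using inj by (rule inj_on_subset) auto
      ultimately show "cyclomatic (V - {x}) E' W'"
        by (intro cyclomatic_belowD[OF below G'])
    qed
  qed
qed

lemma cyclomatic_below_empty: "cyclomatic_below f {} {}"
  unfolding cyclomatic_below_def geodetic_def by auto

lemma two_tree_edges: "two_tree H \<Longrightarrow> e \<in> edges H \<Longrightarrow> e \<subseteq> nodes H"
proof (induction arbitrary: e rule: two_tree.induct)
  case (extend G v a b)
  then have "{a, b} \<subseteq> nodes G" by blast
  then show ?case using extend by auto
qed auto

lemma cyclomatic_below_two_tree: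
  "two_tree H \<Longrightarrow> cyclomatic_below f (nodes H) (edges H)"
proof (induction rule: two_tree.induct)
  case (triangle a b c)
  \<comment> \<open>Here the new vertex is its own neighbour. The degenerate pair
    \<open>{c, c}\<close> is dropped in the next step, as a smaller \<open>F\<close> admits fewer
    graphs.\<close>
  have "cyclomatic_below f {c} {{c}}"
    using cyclomatic_below_extend[OF cyclomatic_below_empty, of c c c f] by simp
  then have "cyclomatic_below f {c} {}"
    unfolding cyclomatic_below_def by auto
  then have "cyclomatic_below f {b, c} {{b, c}}"
    using cyclomatic_below_extend[of f "{c}" "{}" b c c] triangle by simp
  then have "cyclomatic_below f {a, b, c} ({{b, c}} \<union> {{a, b}, {a, c}})"
    by (rule cyclomatic_below_extend) (use triangle in auto)
  then show ?case by (simp add: insert_commute)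
next
  case (extend G v a b)
  have "cyclomatic_below f (insert v (nodes G)) (edges G \<union> {{v, a}, {v, b}})"
    by (rule cyclomatic_below_extend[OF extend.IH two_tree_edges[OF extend.hyps(1)]])
      (use extend.hyps in auto)
  then show ?case by simp
qed

section \<open>Perturbed weights\<close>

lemma gpath_trans_sum:
  assumes "gpath x y Q" "gpath y z R"
  obtains S where "S \<subseteq> Q \<union> R" "gpath x z S" "sum W S \<le> sum W Q + (sum W R :: nat)"
proof -
  obtain S where S: "S \<subseteq> Q \<union> R" "gpath x z S" using gpath_trans[OF assms] by blast
  have fin: "finite Q" "finite R" using gpath_finite[OF assms(1)] gpath_finite[OF assms(2)] .
  have "sum W S \<le> sum W (Q \<union> R)" using S(1) fin by (intro sum_mono2) auto
  also have "\<dots> \<le> sum W Q + sum W R" using fin by (simp add: sum_Un_nat)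
  finally show thesis using that S by blast
qed

definition min_path :: "'a set set \<Rightarrow> ('a set \<Rightarrow> nat) \<Rightarrow> 'a \<Rightarrow> 'a \<Rightarrow> 'a set set \<Rightarrow> bool" where
  "min_path E W x y P \<longleftrightarrow> gpath x y P \<and> P \<subseteq> E \<and> (\<forall>Q. gpath x y Q \<and> Q \<subseteq> E \<longrightarrow> sum W P \<le> sum W Q)"

lemma min_pathD:
  assumes "min_path E W x y P"
  shows "gpath x y P" "P \<subseteq> E" "gpath x y Q \<Longrightarrow> Q \<subseteq> E \<Longrightarrow> sum W P \<le> sum W Q"
  using assms unfolding min_path_def by auto

lemma min_path_sym: "min_path E W x y P \<Longrightarrow> min_path E W y x P"
  unfolding min_path_def using gpath_sym by metis

lemma min_path_prefix:
  assumes m: "min_path E W x z (P \<union> R)" and P: "gpath x y P" "gpath y z R" "P \<inter> R = {}"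
  shows "min_path E W x y P"
  unfolding min_path_def
proof (intro conjI allI impI)
  show "gpath x y P" by (rule P)
  show "P \<subseteq> E" using min_pathD(2)[OF m] by simp
  fix Q assume Q: "gpath x y Q \<and> Q \<subseteq> E"
  then obtain S where S: "S \<subseteq> Q \<union> R" "gpath x z S" "sum W S \<le> sum W Q + sum W R"
    using gpath_trans_sum P(2) by metis
  have "S \<subseteq> E" using S(1) Q min_pathD(2)[OF m] by blast
  then have "sum W (P \<union> R) \<le> sum W S" by (rule min_pathD(3)[OF m S(2)])
  moreover have "sum W (P \<union> R) = sum W P + sum W R"
    using gpath_finite[OF P(1)] gpath_finite[OF P(2)] P(3) by (rule sum.union_disjoint)
  ultimately show "sum W P \<le> sum W Q" using S(3) by simp
qed

lemma min_path_suffix: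
  assumes m: "min_path E W x z (P \<union> R)" and P: "gpath x y P" "gpath y z R" "P \<inter> R = {}"
  shows "min_path E W y z R"
proof -
  have "min_path E W z x (R \<union> P)" using min_path_sym[OF m] by (simp add: Un_commute)
  from min_path_prefix[OF this gpath_sym[OF P(2)] gpath_sym[OF P(1)]] P(3)
  show ?thesis using min_path_sym by (metis Int_commute)
qed

text \<open>Compare the second vertices \<open>y\<close> and \<open>y'\<close>. If they agree, the
  tails are minimal and the induction applies. Otherwise equal vertex sets put \<open>y'\<close> on
  the first path; its prefix \<open>P1\<close> up to \<open>y'\<close> and the single edge
  \<open>{x, y'}\<close> are both minimal, so they have equal weight and hence the same vertices,
  but \<open>P1\<close> contains \<open>y\<close>.\<close>

lemma min_path_unique:
  assumes eq: "\<And>x y P Q. gpath x y P \<Longrightarrow> gpath x y Q \<Longrightarrow> P \<subseteq> E \<Longrightarrow> Q \<subseteq> E \<Longrightarrow>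
      sum W P = sum W Q \<Longrightarrow> \<Union>P = \<Union>Q"
    and P: "min_path E W x z P" and Q: "min_path E W x z Q"
  shows "P = Q"
  using min_pathD(1)[OF P] P Q
proof (induction arbitrary: Q rule: gpath.induct)
  case (refl x)
  then show ?case using min_pathD(1)[OF refl(2)] by simp
next
  case (step y z P x)
  let ?P = "insert {x, y} P"
  note P = step.prems(1) and Q = step.prems(2)
  have "x \<noteq> z" using gpath_ends[OF step.hyps(1)] step.hyps by auto
  then obtain y' Q' where Q': "Q = insert {x, y'} Q'" "gpath y' z Q'" "x \<noteq> y'" "x \<notin> \<Union>Q'" "{x, y'} \<notin> Q'"
    using gpath_first[OF min_pathD(1)[OF Q]] by metis
  have P_split: "min_path E W x z ({{x, y}} \<union> P)" "{{x, y}} \<inter> P = {}"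
    using P step.hyps(3) by auto
  have Q_split: "min_path E W x z ({{x, y'}} \<union> Q')" "{{x, y'}} \<inter> Q' = {}"
    using Q Q' by auto
  note xy = gpath_edge[OF step.hyps(2)] and xy' = gpath_edge[OF Q'(3)]
  show ?case
  proof (cases "y = y'")
    case True
    have "P = Q'"
      using step.IH[OF min_path_suffix[OF P_split(1) xy step.hyps(1) P_split(2)]]
        min_path_suffix[OF Q_split(1) xy' Q'(2) Q_split(2)] True by simp
    then show ?thesis using True Q'(1) by simp
  next
    case False
    note gP = min_pathD(1)[OF P]
    have "sum W ?P = sum W Q"
      using min_pathD(3)[OF P min_pathD(1,2)[OF Q]] min_pathD(3)[OF Q min_pathD(1,2)[OF P]] by simp
    then have "\<Union>?P = \<Union>Q"
      by (rule eq[OF gP min_pathD(1)[OF Q] min_pathD(2)[OF P] min_pathD(2)[OF Q]])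
    then have "y' \<in> insert x (\<Union>?P)" using Q'(1) by simp
    from gpath_split[OF gP this] obtain P1 P2 where S: "?P = P1 \<union> P2" "P1 \<inter> P2 = {}"
      "gpath x y' P1" "gpath y' z P2" by (elim exE conjE)
    have m1: "min_path E W x y' P1"
      using min_path_prefix[OF _ S(3,4,2)] P S(1) by simp
    have m2: "min_path E W x y' {{x, y'}}"
      by (rule min_path_prefix[OF Q_split(1) xy' Q'(2) Q_split(2)])
    have "sum W P1 = sum W {{x, y'}}"
      using min_pathD(3)[OF m1 min_pathD(1,2)[OF m2]] min_pathD(3)[OF m2 min_pathD(1,2)[OF m1]] by simp
    then have U: "\<Union>P1 = {x, y'}" using eq[OF S(3) xy' min_pathD(2)[OF m1] min_pathD(2)[OF m2]] by simp
    obtain c R where c: "P1 = insert {x, c} R" using gpath_first[OF S(3) Q'(3)] by metis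
    then have "{x, c} \<in> ?P" using S(1) by auto
    then have "c = y" using step.hyps(3) by (auto simp: doubleton_eq_iff)
    then have "y \<in> {x, y'}" using U c by auto
    then show ?thesis using False step.hyps(2) by simp
  qed
qed

lemma geo_exists:
  assumes eq: "\<And>x y P Q. gpath x y P \<Longrightarrow> gpath x y Q \<Longrightarrow> P \<subseteq> E \<Longrightarrow> Q \<subseteq> E \<Longrightarrow>
      sum W P = sum W Q \<Longrightarrow> \<Union>P = \<Union>Q"
    and Q: "gpath x y Q" "Q \<subseteq> E"
  shows "\<exists>P. geo E W x y P"
proof -
  obtain P where P: "gpath x y P \<and> P \<subseteq> E"
    and le: "\<And>Q. gpath x y Q \<and> Q \<subseteq> E \<Longrightarrow> sum W P \<le> sum W Q"
    using ex_has_least_nat[of "\<lambda>P. gpath x y P \<and> P \<subseteq> E" Q "sum W"] Q by blast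
  then have m: "min_path E W x y P" unfolding min_path_def by blast
  have "geo E W x y P"
    unfolding geo_def
  proof (intro conjI allI impI)
    fix R assume R: "gpath x y R \<and> R \<subseteq> E \<and> R \<noteq> P"
    show "sum W P < sum W R"
    proof (rule ccontr)
      assume "\<not> sum W P < sum W R"
      then have "sum W R \<le> sum W P" by simp
      then have mR: "min_path E W x y R"
        using R m unfolding min_path_def by (auto intro: le_trans)
      have "P = R" by (rule min_path_unique[OF _ m mR]) (erule (4) eq)
      then show False using R by simp
    qed
  qed (use P in auto)
  then show ?thesis by blast
qed

section \<open>Vertex sets of paths as binary numbers\<close>

lemma gpath_card:
  assumes "gpath x y P"
  shows "card (insert x (\<Union>P)) = Suc (card P)" "finite (\<Union>P)"
proof -
  have "card (insert x (\<Union>P)) = Suc (card P) \<and> finite (\<Union>P)"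
    using assms
  proof (induction rule: gpath.induct)
    case (step y z P x)
    have "insert x (\<Union>(insert {x, y} P)) = insert x (insert y (\<Union>P))" by auto
    moreover have "{x, y} \<notin> P" using step.hyps(3) by auto
    ultimately show ?case using step gpath_finite[OF step.hyps(1)] by simp
  qed simp
  then show "card (insert x (\<Union>P)) = Suc (card P)" "finite (\<Union>P)" by auto
qed

text \<open>Handshake along a path: an inner vertex lies on two edges, an end on one, and
  \<open>c x + c y\<close> makes up for the ends. For the trivial path these two terms are the whole
  sum.\<close>

lemma gpath_double_sum:
  fixes c :: "'a \<Rightarrow> nat"
  assumes "gpath x y P"
  shows "(\<Sum>e\<in>P. sum c e) + c x + c y = 2 * sum c (insert x (\<Union>P))"
  using assms
proof (induction rule: gpath.induct)
  case (step y z P x)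
  have "insert x (\<Union>(insert {x, y} P)) = insert x (insert y (\<Union>P))" by auto
  moreover have "{x, y} \<notin> P" "x \<notin> insert y (\<Union>P)" using step.hyps by auto
  ultimately show ?case
    using step gpath_finite[OF step.hyps(1)] gpath_card(2)[OF step.hyps(1)] by simp
qed simp

text \<open>Binary digits: the largest element of \<open>V\<close> gets 1, and each element
  outweighs all larger ones together. Comparing sums thus means looking at the smallest element in
  which two sets differ.\<close>

definition priority :: "'a::linorder set \<Rightarrow> 'a \<Rightarrow> nat" where
  "priority V x = 2 ^ card {u \<in> V. x < u}"

lemma sum_priority_less:
  fixes A :: "'a::linorder set"
  assumes "finite A"
  shows "sum (priority A) A < 2 ^ card A"
  using assms
proof (induction rule: finite_linorder_max_induct)
  case (insert b A)
  have "priority (insert b A) x = 2 * priority A x" if "x \<in> A" for x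
  proof -
    have "{u \<in> insert b A. x < u} = insert b {u \<in> A. x < u}" using insert.hyps that by auto
    moreover have "b \<notin> {u \<in> A. x < u}" using insert.hyps by auto
    ultimately show ?thesis using insert.hyps(1) unfolding priority_def by simp
  qed
  then have "sum (priority (insert b A)) A = 2 * sum (priority A) A"
    by (simp add: sum_distrib_left)
  moreover have no_larger: "{u \<in> insert b A. b < u} = {}" using insert.hyps by auto
  have "priority (insert b A) b = 1" unfolding priority_def no_larger by simp
  moreover have "b \<notin> A" using insert.hyps by auto
  ultimately show ?case using insert by simp
qed (simp add: priority_def)

lemma sum_priority_lex:
  fixes V :: "'a::linorder set"
  assumes V: "finite V" "S \<subseteq> V" "T \<subseteq> V" and ne: "S - T \<noteq> {}"
    and less: "\<And>t. t \<in> T - S \<Longrightarrow> Min (S - T) < t"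
  shows "sum (priority V) T < sum (priority V) S"
proof -
  let ?m = "Min (S - T)" and ?A = "{u \<in> V. Min (S - T) < u}"
  have fin: "finite S" "finite T" using V finite_subset by auto
  have "sum (priority V) (T - S) \<le> sum (priority V) ?A"
    using V(1,3) less by (intro sum_mono2) auto
  \<comment> \<open>\<open>?A\<close> is upward closed in \<open>V\<close>, so an element of
    \<open>?A\<close> has the same larger elements in both.\<close>
  also have "\<dots> = sum (priority ?A) ?A"
  proof (rule sum.cong)
    fix x assume "x \<in> ?A"
    then have "{u \<in> V. x < u} = {u \<in> ?A. x < u}" by auto
    then show "priority V x = priority ?A x" unfolding priority_def by simp
  qed simp
  also have "\<dots> < 2 ^ card ?A" using V(1) by (intro sum_priority_less) simp
  also have "\<dots> = priority V ?m" unfolding priority_def ..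
  also have "\<dots> \<le> sum (priority V) (S - T)"
    using fin ne by (intro member_le_sum Min_in) auto
  finally show ?thesis
    using sum.Int_Diff[OF fin(1), of "priority V" T] sum.Int_Diff[OF fin(2), of "priority V" S]
    by (simp add: Int_commute)
qed

text \<open>Equal cardinality makes both differences nonempty as soon as the sets differ, so the
  minima are genuine and distinct. Trichotomy then inverts \<open>sum_priority_lex\<close>.\<close>

lemma priority_sets:
  fixes V :: "'a::linorder set"
  assumes V: "finite V" "S \<subseteq> V" "T \<subseteq> V" and card: "card S = card T"
  shows "sum (priority V) T < sum (priority V) S \<Longrightarrow> Min (S - T) < Min (T - S)"
    and "sum (priority V) T = sum (priority V) S \<Longrightarrow> S = T"
proof -
  have fin: "finite S" "finite T" using V finite_subset by auto
  have ne: "S - T \<noteq> {}" "T - S \<noteq> {}" if "S \<noteq> T"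
    using that card fin card_subset_eq by (metis Diff_eq_empty_iff)+
  have lex: "sum (priority V) T < sum (priority V) S" if "S \<noteq> T" "Min (S - T) < Min (T - S)"
    by (rule sum_priority_lex[OF V ne(1)[OF that(1)]])
      (use that(2) fin in \<open>auto intro: less_le_trans\<close>)
  have lex': "sum (priority V) S < sum (priority V) T" if "S \<noteq> T" "Min (T - S) < Min (S - T)"
    by (rule sum_priority_lex[OF V(1,3,2) ne(2)[OF that(1)]])
      (use that(2) fin in \<open>auto intro: less_le_trans\<close>)
  have total: "Min (S - T) \<noteq> Min (T - S)" if "S \<noteq> T"
    using Min_in[OF _ ne(1)[OF that]] Min_in[OF _ ne(2)[OF that]] fin by force
  show "Min (S - T) < Min (T - S)" if "sum (priority V) T < sum (priority V) S"
    using that lex' total by (metis less_asym less_irrefl neqE)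
  show "S = T" if "sum (priority V) T = sum (priority V) S"
    using that lex lex' total by (metis less_irrefl neqE)
qed

lemma nat_digits:
  fixes M :: nat
  assumes "M * a + t \<le> M * b + s" "t < M" "s < M"
  shows "a < b \<or> a = b \<and> t \<le> s"
proof -
  have "\<not> b < a"
  proof
    assume "b < a"
    then have "M * Suc b \<le> M * a" by (intro mult_le_mono2) simp
    then show False using assms by simp
  qed
  then show ?thesis using assms(1) by (cases "a = b") auto
qed

text \<open>Total edge weight, number of edges and vertex priorities as the three digits of one number.
  Each vertex contributes to both of its edges, so along a path between fixed endpoints every
  vertex is counted with a fixed multiplicity.\<close>

definition lex_weight :: "'a::linorder set \<Rightarrow> 'a set set \<Rightarrow> ('a set \<Rightarrow> nat) \<Rightarrow> 'a set \<Rightarrow> nat" where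
  "lex_weight V E w e =
     Suc (card E * (2 * 2 ^ card V)) * (Suc (card E) * w e + 1) + (\<Sum>x\<in>e. 2 ^ card V - priority V x)"

text \<open>The form with \<open>\<le>\<close> serves twice: for a strict inequality the last clause
  excludes equal priority sums, and on a tie the lemma applies in both directions and yields them.
  Priorities are compared in reverse because small labels, that is large priorities, have to make a
  path light.\<close>

lemma lex_weight_less_eq:
  fixes V :: "'a::linorder set" and w :: "'a set \<Rightarrow> nat"
  assumes V: "finite V" and E: "finite E" "\<And>e. e \<in> E \<Longrightarrow> e \<subseteq> V \<and> card e = 2"
    and P: "gpath x y P" "P \<subseteq> E" and Q: "gpath x y Q" "Q \<subseteq> E" and xV: "x \<in> V"
    and le: "sum (lex_weight V E w) P \<le> sum (lex_weight V E w) Q"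
  shows "sum w P < sum w Q \<or> sum w P = sum w Q \<and> card P < card Q \<or>
    sum w P = sum w Q \<and> card P = card Q \<and>
      sum (priority V) (insert x (\<Union>Q)) \<le> sum (priority V) (insert x (\<Union>P)) \<and>
      (sum (priority V) (insert x (\<Union>Q)) = sum (priority V) (insert x (\<Union>P)) \<longrightarrow>
        sum (lex_weight V E w) P = sum (lex_weight V E w) Q)"
proof -
  define K :: nat where "K = 2 ^ card V"
  define c where "c = (\<lambda>z. K - priority V z)"
  define T where "T = (\<lambda>R. \<Sum>e\<in>R. sum c e)"
  \<comment> \<open>\<open>?N\<close> exceeds every number of edges. \<open>?M\<close> exceeds the
    lowest digit: at most \<open>card E\<close> edges with two ends each, and an end contributes at
    most \<open>K\<close>.\<close>
  let ?N = "Suc (card E)" and ?M = "Suc (card E * (2 * K))"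
  have W: "sum (lex_weight V E w) R = ?M * (?N * sum w R + card R) + T R" for R
  proof -
    have "sum (lex_weight V E w) R = (\<Sum>e\<in>R. ?M * (?N * w e + 1)) + T R"
      unfolding lex_weight_def T_def c_def K_def by (simp only: sum.distrib)
    also have "(\<Sum>e\<in>R. ?M * (?N * w e + 1)) = ?M * (?N * sum w R + card R)"
      by (simp only: sum_distrib_left[symmetric] sum.distrib card_eq_sum)
    finally show ?thesis .
  qed
  have T_less: "T R < ?M" and card_less: "card R < ?N" if "R \<subseteq> E" for R
  proof -
    have cR: "card R \<le> card E" using E(1) that by (rule card_mono)
    then show "card R < ?N" by simp
    have "T R \<le> (\<Sum>e\<in>R. 2 * K)"
      unfolding T_def
    proof (rule sum_mono)
      fix e assume "e \<in> R"
      then have "card e = 2" using that E(2) by blast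
      have "sum c e \<le> (\<Sum>z\<in>e. K)" unfolding c_def by (intro sum_mono) simp
      then show "sum c e \<le> 2 * K" using \<open>card e = 2\<close> by simp
    qed
    also have "\<dots> \<le> card E * (2 * K)" using cR by simp
    finally show "T R < ?M" by simp
  qed
  have "?N * sum w P + card P < ?N * sum w Q + card Q \<or>
      ?N * sum w P + card P = ?N * sum w Q + card Q \<and> T P \<le> T Q"
    by (rule nat_digits[OF _ T_less[OF P(2)] T_less[OF Q(2)]]) (use le W in simp)
  then consider "sum w P < sum w Q" | "sum w P = sum w Q" "card P < card Q"
    | "sum w P = sum w Q" "card P = card Q" "T P \<le> T Q"
    using nat_digits[OF _ card_less[OF P(2)] card_less[OF Q(2)], of "sum w P" "sum w Q"]
    by fastforce
  then show ?thesis
  proof cases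
    case 3
    \<comment> \<open>The right-hand side is the same for \<open>P\<close> and \<open>Q\<close>,
      which have equally many edges; so a smaller sum of complements is a larger sum of
      priorities.\<close>
    have sums: "sum c (insert x (\<Union>R)) + sum (priority V) (insert x (\<Union>R)) = Suc (card R) * K"
      if "gpath x y R" for R
    proof -
      have "sum c (insert x (\<Union>R)) + sum (priority V) (insert x (\<Union>R)) = (\<Sum>z\<in>insert x (\<Union>R). K)"
        unfolding sum.distrib[symmetric] c_def
      proof (rule sum.cong)
        fix z
        have "priority V z \<le> K"
          unfolding priority_def K_def using V by (intro power_increasing card_mono) auto
        then show "K - priority V z + priority V z = K" by simp
      qed simp
      then show ?thesis using gpath_card(1)[OF that] by simp
    qed
    have "T P + c x + c y = 2 * sum c (insert x (\<Union>P))" "T Q + c x + c y = 2 * sum c (insert x (\<Union>Q))"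
      using gpath_double_sum[OF P(1), of c] gpath_double_sum[OF Q(1), of c] unfolding T_def by auto
    then show ?thesis using 3 sums[OF P(1)] sums[OF Q(1)] unfolding W by auto
  qed auto
qed

section \<open>Vertex sequences and lex shortest paths\<close>

lemma consecutive_pairs_simps [simp]:
  "consecutive_pairs [] = {}"
  "consecutive_pairs [x] = {}"
  "consecutive_pairs (x # y # xs) = insert {x, y} (consecutive_pairs (y # xs))"
proof -
  show "consecutive_pairs (x # y # xs) = insert {x, y} (consecutive_pairs (y # xs))"
  proof (intro equalityI subsetI)
    fix e assume "e \<in> consecutive_pairs (x # y # xs)"
    then obtain i where i: "Suc i < length (x # y # xs)"
      "e = {(x # y # xs) ! i, (x # y # xs) ! Suc i}"
      unfolding consecutive_pairs_def by blast
    show "e \<in> insert {x, y} (consecutive_pairs (y # xs))"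
    proof (cases i)
      case (Suc j)
      then have "Suc j < length (y # xs)" "e = {(y # xs) ! j, (y # xs) ! Suc j}" using i by simp_all
      then show ?thesis unfolding consecutive_pairs_def by blast
    qed (use i in simp)
  next
    fix e assume "e \<in> insert {x, y} (consecutive_pairs (y # xs))"
    then consider "e = {x, y}" | j where "Suc j < length (y # xs)"
      "e = {(y # xs) ! j, (y # xs) ! Suc j}"
      unfolding consecutive_pairs_def by blast
    then show "e \<in> consecutive_pairs (x # y # xs)"
    proof cases
      case 1
      then have "Suc 0 < length (x # y # xs)" "e = {(x # y # xs) ! 0, (x # y # xs) ! Suc 0}" by simp_all
      then show ?thesis unfolding consecutive_pairs_def by blast
    next
      case 2
      then have "Suc (Suc j) < length (x # y # xs)"
        "e = {(x # y # xs) ! Suc j, (x # y # xs) ! Suc (Suc j)}" by simp_all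
      then show ?thesis unfolding consecutive_pairs_def by blast
    qed
  qed
qed (simp_all add: consecutive_pairs_def)

lemma set_consecutive_pairs:
  "xs \<noteq> [] \<Longrightarrow> set xs = insert (hd xs) (\<Union>(consecutive_pairs xs))"
proof (induction xs)
  case (Cons x xs)
  then show ?case by (cases xs) auto
qed simp

lemma gpath_consecutive_pairs:
  "xs \<noteq> [] \<Longrightarrow> distinct xs \<Longrightarrow> gpath (hd xs) (last xs) (consecutive_pairs xs)"
proof (induction xs)
  case (Cons x xs)
  show ?case
  proof (cases xs)
    case (Cons y ys)
    have "gpath y (last xs) (consecutive_pairs xs)" using Cons.IH Cons.prems Cons by simp
    moreover have "x \<notin> set xs" using Cons.prems by simp
    then have "x \<noteq> y" "x \<notin> \<Union>(consecutive_pairs xs)"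
      using set_consecutive_pairs[of xs] Cons by auto
    ultimately have "gpath x (last xs) (insert {x, y} (consecutive_pairs xs))" by (rule gpath.step)
    then show ?thesis using Cons by simp
  qed simp
qed simp

lemma gpath_list:
  "gpath x y P \<Longrightarrow>
    \<exists>xs. xs \<noteq> [] \<and> distinct xs \<and> hd xs = x \<and> last xs = y \<and> consecutive_pairs xs = P"
proof (induction rule: gpath.induct)
  case (refl x)
  show ?case by (rule exI[of _ "[x]"]) simp
next
  case (step y z P x)
  then obtain xs where xs: "xs \<noteq> []" "distinct xs" "hd xs = y" "last xs = z" "consecutive_pairs xs = P"
    by blast
  then obtain ys where ys: "xs = y # ys" by (cases xs) auto
  have "x \<notin> set xs" using set_consecutive_pairs[OF xs(1)] xs(3,5) step.hyps(2,3) by simp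
  then show ?case using xs ys by (intro exI[of _ "x # xs"]) auto
qed

lemma path_between_iff:
  assumes "simple_graph G" "u \<in> nodes G"
  shows "path_between G u v Q \<longleftrightarrow>
    (\<exists>P. gpath u v P \<and> P \<subseteq> edges G \<and> Q = UGraph (insert u (\<Union>P)) P)"
proof
  assume "path_between G u v Q"
  then obtain xs where xs: "is_subgraph Q G" "xs \<noteq> []" "distinct xs" "hd xs = u" "last xs = v"
    "Q = path_graph xs" unfolding path_between_def by (elim exE conjE)
  have "gpath u v (consecutive_pairs xs)" using gpath_consecutive_pairs[OF xs(2,3)] xs(4,5) by simp
  moreover have "consecutive_pairs xs \<subseteq> edges G"
    using xs(1,6) unfolding is_subgraph_def path_graph_def by simp
  moreover have "Q = UGraph (insert u (\<Union>(consecutive_pairs xs))) (consecutive_pairs xs)"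
    using set_consecutive_pairs[OF xs(2)] xs(4,6) unfolding path_graph_def by simp
  ultimately show "\<exists>P. gpath u v P \<and> P \<subseteq> edges G \<and> Q = UGraph (insert u (\<Union>P)) P" by blast
next
  assume "\<exists>P. gpath u v P \<and> P \<subseteq> edges G \<and> Q = UGraph (insert u (\<Union>P)) P"
  then obtain P where P: "gpath u v P" "P \<subseteq> edges G" "Q = UGraph (insert u (\<Union>P)) P" by blast
  obtain xs where xs: "xs \<noteq> []" "distinct xs" "hd xs = u" "last xs = v" "consecutive_pairs xs = P"
    using gpath_list[OF P(1)] by (elim exE conjE)
  have "Q = path_graph xs" using set_consecutive_pairs[OF xs(1)] xs(3,5) P(3)
    unfolding path_graph_def by simp
  moreover have "is_subgraph Q G"
    using P(2,3) assms unfolding is_subgraph_def simple_graph_def by auto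
  ultimately show "path_between G u v Q" unfolding path_between_def using xs by blast
qed

lemma cycle_of_iff:
  assumes "simple_graph G"
  shows "cycle_of G Q \<longleftrightarrow> (\<exists>C. cyc C \<and> C \<subseteq> edges G \<and> Q = UGraph (\<Union>C) C)"
proof
  assume "cycle_of G Q"
  then obtain xs where xs: "is_subgraph Q G" "3 \<le> length xs" "distinct xs" "Q = cycle_graph xs"
    unfolding cycle_of_def by (elim exE conjE)
  let ?P = "consecutive_pairs xs" and ?x = "hd xs" and ?y = "last xs"
  have ne: "xs \<noteq> []" using xs(2) by auto
  note P = gpath_consecutive_pairs[OF ne xs(3)]
  have set: "set xs = insert ?x (\<Union>?P)" by (rule set_consecutive_pairs[OF ne])
  have card: "3 \<le> card (set xs)" using xs(2,3) by (simp add: distinct_card)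
  have xy: "?x \<noteq> ?y"
  proof
    assume "?x = ?y"
    then have "?P = {}" using P by simp
    then show False using card set by simp
  qed
  \<comment> \<open>An edge between the ends would be a subpath with the same ends, hence the whole
    path, leaving only two vertices.\<close>
  have "{?x, ?y} \<notin> ?P"
  proof
    assume "{?x, ?y} \<in> ?P"
    then have "{{?x, ?y}} = ?P"
      by (intro gpath_subpath_unique[OF P gpath_edge[OF xy] _ P]) auto
    then have "set xs = {?x, ?y}" using set by auto
    then show False using card xy by simp
  qed
  then have "cyc (insert {?x, ?y} ?P)" by (rule cycI[OF P xy])
  moreover have "set xs = \<Union>(insert {?x, ?y} ?P)"
    using gpath_ends[OF P] xy unfolding set by auto
  then have "Q = UGraph (\<Union>(insert {?x, ?y} ?P)) (insert {?x, ?y} ?P)"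
    using xs(4) unfolding cycle_graph_def by (simp add: insert_commute)
  moreover from this have "insert {?x, ?y} ?P \<subseteq> edges G"
    using xs(1) unfolding is_subgraph_def by simp
  ultimately show "\<exists>C. cyc C \<and> C \<subseteq> edges G \<and> Q = UGraph (\<Union>C) C" by blast
next
  assume "\<exists>C. cyc C \<and> C \<subseteq> edges G \<and> Q = UGraph (\<Union>C) C"
  then obtain C where C: "cyc C" "C \<subseteq> edges G" "Q = UGraph (\<Union>C) C" by blast
  obtain x y P where P: "gpath x y P" "x \<noteq> y" "{x, y} \<notin> P" "C = insert {x, y} P"
    using C(1) unfolding cyc_def by (elim exE conjE)
  obtain xs where xs: "xs \<noteq> []" "distinct xs" "hd xs = x" "last xs = y" "consecutive_pairs xs = P"
    using gpath_list[OF P(1)] by (elim exE conjE)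
  have set: "set xs = \<Union>C"
    using set_consecutive_pairs[OF xs(1)] xs(3,5) gpath_ends[OF P(1)] P(2) unfolding P(4) by auto
  have "3 \<le> length xs"
  proof (rule ccontr)
    assume "\<not> 3 \<le> length xs"
    then obtain z where "xs = [z] \<or> (\<exists>u. xs = [z, u])" using xs(1)
      by (cases xs; cases "tl xs"; cases "tl (tl xs)") auto
    then show False using xs(3-5) P(2,3) by auto
  qed
  moreover have "Q = cycle_graph xs"
    using set xs(3-5) C(3) P(4) unfolding cycle_graph_def by (simp add: insert_commute)
  moreover have "is_subgraph Q G"
    using C(2,3) assms unfolding is_subgraph_def simple_graph_def by auto
  ultimately show "cycle_of G Q" unfolding cycle_of_def using xs(2) by blast
qed

section \<open>Perturbed shortest paths are the lex shortest paths\<close>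

context
  fixes G :: "'a::linorder ugraph" and w :: "'a set \<Rightarrow> nat"
  assumes simple: "simple_graph G"
begin

abbreviation "lexw \<equiv> lex_weight (nodes G) (edges G) w"

lemma simple_graphD:
  "finite (nodes G)" "finite (edges G)" "e \<in> edges G \<Longrightarrow> e \<subseteq> nodes G \<and> card e = 2"
proof -
  show "finite (nodes G)" "e \<in> edges G \<Longrightarrow> e \<subseteq> nodes G \<and> card e = 2"
    using simple unfolding simple_graph_def by auto
  show "finite (edges G)"
    by (rule finite_subset[of _ "Pow (nodes G)"]) (use simple in \<open>auto simp: simple_graph_def\<close>)
qed

text \<open>Supplies the hypothesis of \<open>geo_exists\<close>: a tie forces equal edge numbers
  and priority sums, and a binary sum determines its set. The paths may still visit the vertices in
  different orders.\<close>

lemma lexw_equal: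
  assumes P: "gpath x y P" "P \<subseteq> edges G" and Q: "gpath x y Q" "Q \<subseteq> edges G"
    and eq: "sum lexw P = sum lexw Q"
  shows "\<Union>P = \<Union>Q"
proof (cases "x = y")
  case True
  then show ?thesis using P Q by simp
next
  case False
  note endsP = gpath_ends[OF P(1)] and endsQ = gpath_ends[OF Q(1)]
  have sub: "\<Union>P \<subseteq> nodes G" "\<Union>Q \<subseteq> nodes G" using P(2) Q(2) simple_graphD(3) by blast+
  have x: "x \<in> \<Union>P" "x \<in> \<Union>Q" using endsP endsQ False by auto
  then have xV: "x \<in> nodes G" using sub by blast
  note le = lex_weight_less_eq[OF simple_graphD(1,2) simple_graphD(3)]
  have "card P = card Q" "sum (priority (nodes G)) (\<Union>Q) = sum (priority (nodes G)) (\<Union>P)"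
    using le[OF _ P Q xV, of w] le[OF _ Q P xV, of w] eq x by (auto simp: insert_absorb)
  moreover have "card (\<Union>P) = card (\<Union>Q)"
    using gpath_card(1)[OF P(1)] gpath_card(1)[OF Q(1)] x calculation(1) by (simp add: insert_absorb)
  ultimately show ?thesis using priority_sets(2)[OF simple_graphD(1) sub] by simp
qed

text \<open>The three alternatives are asymmetric: two distinct lex shortest paths would each have
  to beat the other. So exhibiting one determines \<open>THE\<close>.\<close>

lemma lsp_geo:
  assumes uv: "u \<in> nodes G" and P: "geo (edges G) lexw u v P"
  shows "lsp G w u v = UGraph (insert u (\<Union>P)) P"
proof -
  let ?better = "\<lambda>P P'. graph_weight w P' > graph_weight w P \<or>
        graph_weight w P' = graph_weight w P \<and> card (edges P') > card (edges P) \<or>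
        graph_weight w P' = graph_weight w P \<and> card (edges P') = card (edges P) \<and>
          Min (nodes P' - nodes P) > Min (nodes P - nodes P')"
  let ?P = "UGraph (insert u (\<Union>P)) P"
  note path_iff = path_between_iff[OF simple uv]
  have path: "path_between G u v ?P" unfolding path_iff using geoD[OF P] by blast
  have better: "?better ?P Q" if Q: "path_between G u v Q" "Q \<noteq> ?P" for Q
  proof -
    obtain R where R: "gpath u v R" "R \<subseteq> edges G" "Q = UGraph (insert u (\<Union>R)) R"
      using Q(1) unfolding path_iff by blast
    have "R \<noteq> P" using Q(2) R(3) by blast
    then have less: "sum lexw P < sum lexw R" by (rule geo_less[OF P R(1,2)])
    note le = lex_weight_less_eq[OF simple_graphD(1,2) simple_graphD(3) geoD[OF P] R(1,2) uv, of w]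
    have sub: "insert u (\<Union>P) \<subseteq> nodes G" "insert u (\<Union>R) \<subseteq> nodes G"
      using geoD(2)[OF P] R(2) simple_graphD(3) uv by blast+
    have "Min (insert u (\<Union>P) - insert u (\<Union>R)) < Min (insert u (\<Union>R) - insert u (\<Union>P))"
      if eq: "card P = card R"
        "sum (priority (nodes G)) (insert u (\<Union>R)) < sum (priority (nodes G)) (insert u (\<Union>P))"
    proof -
      have card: "card (insert u (\<Union>P)) = card (insert u (\<Union>R))"
        using gpath_card(1)[OF geoD(1)[OF P]] gpath_card(1)[OF R(1)] eq(1) by simp
      show ?thesis by (rule priority_sets(1)[OF simple_graphD(1) sub card eq(2)])
    qed
    \<comment> \<open>Equal vertex sets, for which the comparison of minima would fail, cannot occur
      in the third alternative: by \<open>le\<close> they would make the perturbed weights equal,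
      against \<open>less\<close>.\<close>
    then show ?thesis using le less R(3) unfolding graph_weight_def by auto
  qed
  have lex: "is_lex_shortest_path G w u v ?P"
    unfolding is_lex_shortest_path_def using path better by blast
  show ?thesis
    unfolding lsp_def
  proof (rule the_equality)
    show "is_lex_shortest_path G w u v ?P" by (rule lex)
    fix Q assume Q: "is_lex_shortest_path G w u v Q"
    show "Q = ?P"
    proof (rule ccontr)
      assume ne: "Q \<noteq> ?P"
      have "?better Q ?P" using Q path ne unfolding is_lex_shortest_path_def by blast
      moreover have "?better ?P Q" using better[OF _ ne] Q unfolding is_lex_shortest_path_def by blast
      ultimately show False by auto
    qed
  qed
qed

lemma geodetic_lexw:
  assumes "connected_graph G"
  shows "geodetic (nodes G) (edges G) lexw"
  unfolding geodetic_def
proof (intro conjI ballI)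
  show "nodes G \<noteq> {}" using assms unfolding connected_graph_def by simp
  fix x y assume xy: "x \<in> nodes G" "y \<in> nodes G"
  then obtain Q where "path_between G x y Q" using assms unfolding connected_graph_def by blast
  then obtain P where "gpath x y P" "P \<subseteq> edges G" unfolding path_between_iff[OF simple xy(1)] by blast
  then show "\<exists>P. geo (edges G) lexw x y P" using geo_exists lexw_equal by metis
qed (use simple_graphD in auto)

lemma lex_short_cycle_iff:
  assumes "connected_graph G"
  shows "lex_short_cycle G w Q \<longleftrightarrow> (\<exists>C. short (edges G) lexw C \<and> Q = UGraph (\<Union>C) C)"
proof -
  have "(\<forall>x\<in>\<Union>C. \<forall>y\<in>\<Union>C. x \<noteq> y \<longrightarrow> is_subgraph (lsp G w x y) (UGraph (\<Union>C) C)) \<longleftrightarrow>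
      (\<forall>x\<in>\<Union>C. \<forall>y\<in>\<Union>C. \<forall>P. geo (edges G) lexw x y P \<longrightarrow> P \<subseteq> C)"
    if C: "C \<subseteq> edges G" for C
  proof (intro ball_cong HOL.refl)
    fix x y assume xy: "x \<in> \<Union>C" "y \<in> \<Union>C"
    then have nodes: "x \<in> nodes G" "y \<in> nodes G" using C simple_graphD(3) by blast+
    obtain P where P: "geo (edges G) lexw x y P"
      using geodeticD(5)[OF geodetic_lexw[OF assms] nodes] by blast
    have "is_subgraph (lsp G w x y) (UGraph (\<Union>C) C) \<longleftrightarrow> P \<subseteq> C"
      using xy unfolding lsp_geo[OF nodes(1) P] is_subgraph_def by auto
    \<comment> \<open>\<open>lex_short_cycle\<close> skips \<open>x = y\<close>;
      \<open>short\<close> does not, but there the shortest path is empty.\<close>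
    moreover have "P = {}" if "x = y" using geoD(1)[OF P] that by simp
    moreover have "geo (edges G) lexw x y R \<longleftrightarrow> R = P" for R using geo_unique[OF P] P by blast
    ultimately show "(x \<noteq> y \<longrightarrow> is_subgraph (lsp G w x y) (UGraph (\<Union>C) C)) \<longleftrightarrow>
        (\<forall>P. geo (edges G) lexw x y P \<longrightarrow> P \<subseteq> C)" by auto
  qed
  note subgraph_iff = this
  show ?thesis
  proof
    assume Q: "lex_short_cycle G w Q"
    then obtain C where C: "cyc C" "C \<subseteq> edges G" "Q = UGraph (\<Union>C) C"
      unfolding lex_short_cycle_def cycle_of_iff[OF simple] by blast
    have "\<forall>x\<in>\<Union>C. \<forall>y\<in>\<Union>C. x \<noteq> y \<longrightarrow> is_subgraph (lsp G w x y) (UGraph (\<Union>C) C)"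
      using Q unfolding lex_short_cycle_def C(3) ugraph.sel by blast
    then show "\<exists>C. short (edges G) lexw C \<and> Q = UGraph (\<Union>C) C"
      using C unfolding subgraph_iff[OF C(2)] short_def by blast
  next
    assume "\<exists>C. short (edges G) lexw C \<and> Q = UGraph (\<Union>C) C"
    then obtain C where C: "short (edges G) lexw C" "Q = UGraph (\<Union>C) C" by blast
    then have "cycle_of G Q" using shortD(1,2)[OF C(1)] unfolding cycle_of_iff[OF simple] by blast
    moreover have "\<forall>x\<in>\<Union>C. \<forall>y\<in>\<Union>C. x \<noteq> y \<longrightarrow> is_subgraph (lsp G w x y) (UGraph (\<Union>C) C)"
      using C(1) unfolding subgraph_iff[OF shortD(2)[OF C(1)]] short_def by (elim conjE)
    ultimately show "lex_short_cycle G w Q" unfolding lex_short_cycle_def C(2) ugraph.sel by blast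
  qed
qed

end

theorem theorem1:
  fixes G :: "'a::linorder ugraph" and w :: "'a set \<Rightarrow> nat"
  assumes "simple_graph G"
    and "connected_graph G"
    and "partial_two_tree G"
  shows "int (card {C. lex_short_cycle G w C})
           = int (card (edges G)) - int (card (nodes G)) + 1"
proof -
  define W where "W = lex_weight (nodes G) (edges G) w"
  have geodetic: "geodetic (nodes G) (edges G) W"
    unfolding W_def by (rule geodetic_lexw[OF assms(1,2)])
  obtain H :: "nat ugraph" and f where H: "two_tree H" "inj_on f (nodes G)"
    "is_subgraph (UGraph (f ` nodes G) ((`) f ` edges G)) H"
    using assms(3) unfolding partial_two_tree_def by blast
  then have "cyclomatic (nodes G) (edges G) W"
    using cyclomatic_belowD[OF cyclomatic_below_two_tree[OF H(1)] geodetic H(2)]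
    unfolding is_subgraph_def by simp
  moreover have "{C. lex_short_cycle G w C} = (\<lambda>C. UGraph (\<Union>C) C) ` {C. short (edges G) W C}"
    unfolding lex_short_cycle_iff[OF assms(1,2)] W_def by blast
  then have "card {C. lex_short_cycle G w C} = card {C. short (edges G) W C}"
    by (simp add: card_image inj_on_def)
  ultimately show ?thesis unfolding cyclomatic_def by simp
qed

end
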